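(* Fix an integer $m\ge 1$, $q\in(0,1]$, $r\in(1/2,1]$ with $r$ and $q$ not both equal to $1$, and a positive integer $R$. Let $\sigma=(2r-1)q$. Let $\mu$ be a probability distribution on $\mathbb{Z}$ and let $(X_n,n\ge 0)$ be the generalized cooperative motion with initial distribution $\mu$ and i.i.d. steps $(D_n,n\ge 0)$ satisfying $\mathbf{P}(D_n=R)=rq$, $\mathbf{P}(D_n=0)=1-q$, $\mathbf{P}(D_n=-R)=(1-r)q$. For $j\in\{1,2,\dots,R\}$ write $\pi_j=\mathbf{P}(X_0\equiv j \bmod R)$. Then, as $n\to\infty$, $$\frac{1}{R}\,\frac{1}{m+1}\left(\frac{m^m}{\sigma n}\right)^{1/(m+1)}X_n \xrightarrow{d} B\cdot\sum_{j=1}^{R}(\pi_j)^{m/(m+1)}\mathbf{1}_{\{A=j\}},$$ where $A$ is a random variable taking values in $\{1,2,\dots,R\}$ with $\mathbf{P}(A=j)=\pi_j$, and $B$ is $\mathrm{Beta}\left(\frac{m+1}{m},1\right)$-distributed and independent of $A$.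
   Context: Generalized cooperative motion: let $(D_n,n\ge 0)$ be i.i.d. bounded integer-valued random variables, and let $X_0$ have law $\mu$ (independent of the $D_n$). Given $X_n$, let $\tilde X_n^1,\dots,\tilde X_n^m$ be independent copies of $X_n$ (random variables with the same law as $X_n$, with $X_n,\tilde X_n^1,\dots,\tilde X_n^m,D_n$ mutually independent), and set $X_{n+1}=X_n+D_n$ if $X_n=\tilde X_n^i$ for all $i=1,\dots,m$, and $X_{n+1}=X_n$ otherwise. $\xrightarrow{d}$ denotes convergence in distribution. The $\mathrm{Beta}(\alpha,1)$ distribution has distribution function $x^\alpha$ on $[0,1]$. *)

theory Defs
  imports "HOL-Probability.Probability" "HOL-Number_Theory.Cong"
begin

(* X n is the position at time n, Xc n i (1 \<le> i \<le> m) are the independent copies of X n, and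
   D n are the steps.  The second assumption says jointly that the D n are independent of each
   other and of X 0. *)
locale generalized_cooperative_motion = prob_space M
  for M :: "'a measure" +
  fixes m :: nat
    and \<mu> :: "int pmf"
    and X :: "nat \<Rightarrow> 'a \<Rightarrow> int"
    and Xc :: "nat \<Rightarrow> nat \<Rightarrow> 'a \<Rightarrow> int"
    and D :: "nat \<Rightarrow> 'a \<Rightarrow> int"
  assumes initial_law: "distr M (count_space UNIV) (X 0) = measure_pmf \<mu>"
    and indep_initial_steps:
      "indep_vars (\<lambda>_. count_space UNIV) (case_nat (X 0) D) UNIV"
    and steps_identically_distributed:
      "\<And>n. distr M (count_space UNIV) (D n) = distr M (count_space UNIV) (D 0)"
    and steps_bounded: "\<exists>K. \<forall>n. AE \<omega> in M. \<bar>D n \<omega>\<bar> \<le> K"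
    and copies_law:
      "\<And>n i. i \<in> {1..m} \<Longrightarrow>
        distr M (count_space UNIV) (Xc n i) = distr M (count_space UNIV) (X n)"
    and indep_copies_step:
      "\<And>n. indep_vars (\<lambda>_. count_space UNIV)
        (\<lambda>i. if i = 0 then X n else if i \<le> m then Xc n i else D n) {0..m + 1}"
    and motion_step:
      "\<And>n \<omega>. \<omega> \<in> space M \<Longrightarrow>
        X (Suc n) \<omega> = (if \<forall>i\<in>{1..m}. X n \<omega> = Xc n i \<omega> then X n \<omega> + D n \<omega> else X n \<omega>)"

definition beta_one_cdf :: "real \<Rightarrow> real \<Rightarrow> real" where
  "beta_one_cdf \<alpha> x = (if x < 0 then 0 else if x \<le> 1 then x powr \<alpha> else 1)"

(* B is Beta(\<alpha>,1)-distributed on the probability space N. *)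
definition beta_one_distributed :: "'b measure \<Rightarrow> real \<Rightarrow> ('b \<Rightarrow> real) \<Rightarrow> bool" where
  "beta_one_distributed N \<alpha> B \<longleftrightarrow>
     B \<in> borel_measurable N \<and> cdf (distr N borel B) = beta_one_cdf \<alpha>"

end

theory Submission
  imports Defs
begin

text \<open>
  The motion never leaves its residue class modulo \<open>R\<close>, so each class
  can be treated separately.  Let \<open>F n k\<close> be the probability that the walker is at time \<open>n\<close> in the
  given class and at or to the left of its \<open>k\<close>-th site, and let \<open>a n k = F n k - F n (k - 1)\<close>.  A jump
  from a site of mass \<open>a\<close> needs \<open>m\<close> coinciding copies, so it occurs with probability proportional
  to \<open>a ^ (m + 1)\<close>, and
  \<open>F (n + 1) k = F n k - r q (a n k) ^ (m + 1) + (1 - r) q (a n (k + 1)) ^ (m + 1)\<close>.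
  This is a finite difference scheme for the Hamilton-Jacobi equation
  \<open>f\<^sub>t + \<sigma> (f\<^sub>x) ^ (m + 1) = 0\<close>.  The solution that starts as a single jump of height \<open>\<pi>\<close> at the
  origin is the minimum of \<open>\<pi>\<close> and a multiple of \<open>x powr ((m + 1) / m) * t powr (- 1 / m)\<close>.  At the
  scale of the theorem this is \<open>min \<pi> (y powr ((m + 1) / m))\<close>, which is \<open>\<pi>\<close> times the
  distribution function of \<open>\<pi> powr (m / (m + 1)) * B\<close>.  Summing over the classes gives
  the mixture in the theorem.

  The scheme is shown to follow this solution by comparison, in three steps.

  \<^item> The update is monotone in \<open>F\<close> (\<open>hj_step_mono\<close>), but only while the increments \<open>a\<close> are below
    a fixed threshold, and a large point mass can violate this.  The largest increment
    tends to \<open>0\<close> (\<open>density_eventually_small\<close>), because an increment close to the maximum forces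
    two neighbouring increments one step earlier to be close to the maximum, hence \<open>j + 1\<close> of them
    \<open>j\<close> steps earlier, and these would have total mass above \<open>1\<close>.  This is where \<open>r = q = 1\<close> is excluded: in
    that case a point mass travels forever.

  \<^item> Once the scheme is monotone, \<open>F\<close> stays below any supersolution and above any
    subsolution that bounds it at one time.  Both are built from \<open>source_wave\<close>, whose
    increments are exactly proportional to the \<open>m\<close>-th root of \<open>k / t\<close>.  Waves that are slightly
    too steep or slightly too shallow are a supersolution and a subsolution up to errors
    summable in time; starting the barriers late makes the sum of the errors small
    (\<open>upper_barrier\<close>, \<open>lower_barrier\<close>).  For the lower barrier the wave has to be capped at the total
    mass, and the cap is a concave function with slope in the unit interval, because such
    functions preserve subsolutions.

  \<^item> A barrier only has to dominate \<open>F\<close> up to a small \<open>\<epsilon>\<close> at its starting time, so that translating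
    it by a constant copes with an arbitrary initial law.  Constants do not
    survive the scaling, and letting \<open>\<epsilon>\<close> and the perturbation of the slope tend to zero
    gives the limit (\<open>scaling_limit\<close>).
\<close>

section \<open>The update rule of the distribution functions\<close>

lemma power_Suc_diff_le:
  fixes u v \<theta> :: real
  assumes "0 \<le> v" "v \<le> u" "u \<le> \<theta>"
  shows "u ^ Suc n - v ^ Suc n \<le> real (Suc n) * \<theta> ^ n * (u - v)"
proof (induction n)
  case (Suc n)
  have "u ^ Suc (Suc n) - v ^ Suc (Suc n) = u * (u ^ Suc n - v ^ Suc n) + v ^ Suc n * (u - v)"
    by (simp add: algebra_simps)
  also have "\<dots> \<le> \<theta> * (real (Suc n) * \<theta> ^ n * (u - v)) + \<theta> ^ Suc n * (u - v)"
  proof (rule add_mono)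
    show "u * (u ^ Suc n - v ^ Suc n) \<le> \<theta> * (real (Suc n) * \<theta> ^ n * (u - v))"
    proof (rule mult_mono)
      show "0 \<le> u ^ Suc n - v ^ Suc n"
        using power_mono[OF assms(2,1), of "Suc n"] by simp
    qed (use assms Suc.IH in auto)
    show "v ^ Suc n * (u - v) \<le> \<theta> ^ Suc n * (u - v)"
      using assms by (intro mult_right_mono power_mono) auto
  qed
  also have "\<dots> = real (Suc (Suc n)) * \<theta> ^ Suc n * (u - v)"
    by (simp add: algebra_simps)
  finally show ?case .
qed simp

lemma power_Suc_diff_le_gap:
  fixes u v \<theta> d :: real
  assumes "0 \<le> u" "u \<le> \<theta>" "0 \<le> v" "u - v \<le> d" "0 \<le> d"
  shows "u ^ Suc n - v ^ Suc n \<le> real (Suc n) * \<theta> ^ n * d"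
proof (cases "v \<le> u")
  case True
  have "u ^ Suc n - v ^ Suc n \<le> real (Suc n) * \<theta> ^ n * (u - v)"
    using power_Suc_diff_le assms True by blast
  also have "\<dots> \<le> real (Suc n) * \<theta> ^ n * d"
    using assms by (intro mult_left_mono) auto
  finally show ?thesis .
next
  case False
  have "u ^ Suc n \<le> v ^ Suc n" using False assms by (intro power_mono) auto
  moreover have "0 \<le> real (Suc n) * \<theta> ^ n * d" using assms by auto
  ultimately show ?thesis by linarith
qed

text \<open>
  The arguments \<open>x\<close>, \<open>y\<close>, \<open>z\<close> are the values of a distribution function at three consecutive sites.
  The mass \<open>y - x\<close> of the middle site sends \<open>\<alpha> * (y - x) ^ Suc m\<close> to the right, out of the half line counted by \<open>y\<close>,
  and the next site sends \<open>\<beta> * (z - y) ^ Suc m\<close> into it.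
\<close>

definition hj_step :: "nat \<Rightarrow> real \<Rightarrow> real \<Rightarrow> real \<Rightarrow> real \<Rightarrow> real \<Rightarrow> real" where
  "hj_step m \<alpha> \<beta> x y z = y - \<alpha> * (y - x) ^ Suc m + \<beta> * (z - y) ^ Suc m"

lemma hj_step_add_const: "hj_step m \<alpha> \<beta> (x + c) (y + c) (z + c) = hj_step m \<alpha> \<beta> x y z + c"
  by (simp add: hj_step_def)

text \<open>
  Raising the middle value by \<open>d = y' - y\<close> can enlarge the outgoing and reduce the incoming mass,
  but the gap to either neighbour moves in the harmful direction by at most \<open>d\<close>.
  With increments below \<open>\<theta>\<close> the net loss is therefore at most \<open>d\<close>.
\<close>

lemma hj_step_mono:
  fixes \<theta> :: real
  assumes coeff: "0 \<le> \<alpha>" "0 \<le> \<beta>" "(\<alpha> + \<beta>) * (real (Suc m) * \<theta> ^ m) \<le> 1"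
    and le: "x \<le> x'" "y \<le> y'" "z \<le> z'"
    and low: "x \<le> y" "y \<le> z" "z - y \<le> \<theta>"
    and high: "x' \<le> y'" "y' \<le> z'" "y' - x' \<le> \<theta>"
  shows "hj_step m \<alpha> \<beta> x y z \<le> hj_step m \<alpha> \<beta> x' y' z'"
proof -
  define d where "d = y' - y"
  have "(y' - x') ^ Suc m - (y - x) ^ Suc m \<le> real (Suc m) * \<theta> ^ m * d"
    using le low high by (intro power_Suc_diff_le_gap) (auto simp: d_def)
  from mult_left_mono[OF this coeff(1)]
  have 1: "\<alpha> * ((y' - x') ^ Suc m - (y - x) ^ Suc m) \<le> \<alpha> * (real (Suc m) * \<theta> ^ m) * d"
    by (simp add: mult.assoc)
  have "(z - y) ^ Suc m - (z' - y') ^ Suc m \<le> real (Suc m) * \<theta> ^ m * d"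
    using le low high by (intro power_Suc_diff_le_gap) (auto simp: d_def)
  from mult_left_mono[OF this coeff(2)]
  have 2: "\<beta> * ((z - y) ^ Suc m - (z' - y') ^ Suc m) \<le> \<beta> * (real (Suc m) * \<theta> ^ m) * d"
    by (simp add: mult.assoc)
  have "(\<alpha> + \<beta>) * (real (Suc m) * \<theta> ^ m) * d \<le> 1 * d"
    using coeff le by (intro mult_right_mono) (auto simp: d_def)
  then have 3: "\<alpha> * (real (Suc m) * \<theta> ^ m) * d + \<beta> * (real (Suc m) * \<theta> ^ m) * d \<le> d"
    by (simp add: algebra_simps)
  have "hj_step m \<alpha> \<beta> x' y' z' - hj_step m \<alpha> \<beta> x y z
      = d - \<alpha> * ((y' - x') ^ Suc m - (y - x) ^ Suc m) - \<beta> * ((z - y) ^ Suc m - (z' - y') ^ Suc m)"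
    unfolding hj_step_def d_def by (simp only: right_diff_distrib)
  then show ?thesis using 1 2 3 by linarith
qed

section \<open>Decay of the largest atom\<close>

text \<open>
  The factor \<open>P\<close> is the sum of the monomials \<open>u ^ i * y ^ (m - i)\<close>; the bounds say that it is at
  least each pure power and at most the full binomial expansion.
\<close>

lemma power_Suc_diff_factor:
  fixes u y :: real
  assumes "0 \<le> u" "0 \<le> y"
  shows "\<exists>P. u ^ Suc m - y ^ Suc m = (u - y) * P \<and> u ^ m \<le> P \<and> y ^ m \<le> P \<and> P \<le> (u + y) ^ m"
proof (induction m)
  case 0
  show ?case by (rule exI[of _ 1]) simp
next
  case (Suc m)
  then obtain P where P: "u ^ Suc m - y ^ Suc m = (u - y) * P" "u ^ m \<le> P" "y ^ m \<le> P"
      "P \<le> (u + y) ^ m" by blast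
  have P0: "0 \<le> P" using P(2) zero_le_power[OF assms(1), of m] by linarith
  have "u ^ Suc (Suc m) - y ^ Suc (Suc m) = u * (u ^ Suc m - y ^ Suc m) + y ^ Suc m * (u - y)"
    by (simp add: algebra_simps)
  also have "\<dots> = (u - y) * (u * P + y ^ Suc m)"
    unfolding P(1) by (simp add: algebra_simps)
  finally have e: "u ^ Suc (Suc m) - y ^ Suc (Suc m) = (u - y) * (u * P + y ^ Suc m)" .
  have "u * u ^ m \<le> u * P" using P(2) assms by (intro mult_left_mono) auto
  then have 1: "u ^ Suc m \<le> u * P + y ^ Suc m"
    using zero_le_power[OF assms(2), of "Suc m"] by (simp del: zero_le_power)
  have 2: "y ^ Suc m \<le> u * P + y ^ Suc m" using P0 assms by simp
  have "u * P \<le> u * (u + y) ^ m" using P(4) assms by (intro mult_left_mono) auto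
  moreover have "y * y ^ m \<le> y * (u + y) ^ m"
    using assms by (intro mult_left_mono power_mono) auto
  ultimately have 3: "u * P + y ^ Suc m \<le> (u + y) ^ Suc m" by (simp add: algebra_simps)
  show ?case using e 1 2 3 by blast
qed

text \<open>
  A lower bound for the weights that a site and its left neighbour receive in the convex combination below, once the
  combination is at least three quarters of an upper bound for its entries and this bound is at least \<open>l\<close>.
\<close>

definition flux_weight :: "real \<Rightarrow> real \<Rightarrow> nat \<Rightarrow> real \<Rightarrow> real" where
  "flux_weight q r m l = min ((1 - q * r) * l / 4) (r * q * (l / 2) ^ m)"

lemma flux_weight_pos: "0 < q \<Longrightarrow> 0 < r \<Longrightarrow> q * r < 1 \<Longrightarrow> 0 < l \<Longrightarrow> 0 < flux_weight q r m l"
  unfolding flux_weight_def by auto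

lemma flux_weight_le_one:
  "0 < q \<Longrightarrow> 0 < r \<Longrightarrow> 0 < l \<Longrightarrow> l \<le> 1 \<Longrightarrow> flux_weight q r m l \<le> 1"
proof -
  assume a: "0 < q" "0 < r" "0 < l" "l \<le> 1"
  have "(1 - q * r) * l \<le> 1 * 1" using a by (intro mult_mono) auto
  then show ?thesis unfolding flux_weight_def by auto
qed

text \<open>
  Factoring \<open>u ^ Suc m - y ^ Suc m = (u - y) * P\<close> exhibits the new mass \<open>z\<close> as a convex combination
  of \<open>u\<close>, \<open>y\<close>, \<open>v\<close>; that the weight of \<open>y\<close> is nonnegative uses that the total mass is at most \<open>1\<close>.
  Hence the maximum cannot increase, even for large masses where the update of the
  distribution function is not monotone.  If \<open>z\<close> is within \<open>d\<close> of the upper bound \<open>U\<close>, then every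
  entry with weight at least \<open>\<kappa>\<close> is within \<open>d / \<kappa>\<close> of it, and \<open>flux_weight\<close> is such a \<open>\<kappa>\<close> for
  \<open>y\<close> and \<open>u\<close>.
\<close>

lemma density_step_convex:
  fixes u y v q r :: real
  assumes m: "m \<ge> 1" and q: "0 < q" "q \<le> 1" and r: "1 / 2 < r" "r \<le> 1"
    and nonneg: "0 \<le> u" "0 \<le> y" "0 \<le> v" and mass: "u + y + v \<le> 1"
    and U: "u \<le> U" "y \<le> U" "v \<le> U"
  defines "z \<equiv> y + r * q * (u ^ Suc m - y ^ Suc m) + (1 - r) * q * (v ^ Suc m - y ^ Suc m)"
  shows "z \<le> U"
    and "\<And>l d. q * r < 1 \<Longrightarrow> 0 < l \<Longrightarrow> l \<le> U \<Longrightarrow> U - d \<le> z \<Longrightarrow> d \<le> U / 4 \<Longrightarrow>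
      flux_weight q r m l * (U - y) \<le> d \<and> flux_weight q r m l * (U - u) \<le> d"
proof -
  obtain P where P: "u ^ Suc m - y ^ Suc m = (u - y) * P" "u ^ m \<le> P" "y ^ m \<le> P" "P \<le> (u + y) ^ m"
    using power_Suc_diff_factor[OF nonneg(1,2)] by blast
  obtain Q where Q: "v ^ Suc m - y ^ Suc m = (v - y) * Q" "v ^ m \<le> Q" "y ^ m \<le> Q" "Q \<le> (v + y) ^ m"
    using power_Suc_diff_factor[OF nonneg(3,2)] by blast
  have P0: "0 \<le> P" using P(2) zero_le_power[OF nonneg(1), of m] by linarith
  have Q0: "0 \<le> Q" using Q(2) zero_le_power[OF nonneg(3), of m] by linarith
  have pw: "x ^ m \<le> x" if "0 \<le> x" "x \<le> 1" for x :: real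
    using power_decreasing[of 1 m x] m that by simp
  have P1: "P \<le> u + y" using P(4) pw[of "u + y"] nonneg mass by linarith
  have Q1: "Q \<le> v + y" using Q(4) pw[of "v + y"] nonneg mass by linarith
  define \<alpha> where "\<alpha> = r * q * P"
  define \<beta> where "\<beta> = (1 - r) * q * Q"
  define \<gamma> where "\<gamma> = 1 - \<alpha> - \<beta>"
  have \<alpha>0: "0 \<le> \<alpha>" and \<beta>0: "0 \<le> \<beta>" using P0 Q0 q r by (auto simp: \<alpha>_def \<beta>_def)
  have z: "z = \<gamma> * y + \<alpha> * u + \<beta> * v"
    unfolding z_def P(1) Q(1) \<gamma>_def \<alpha>_def \<beta>_def by (simp add: algebra_simps)
  have "r * P + (1 - r) * Q \<le> r * (u + y) + (1 - r) * (v + y)"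
    using P1 Q1 r by (intro add_mono mult_left_mono) auto
  also have "\<dots> = y + r * u + (1 - r) * v" by (simp add: algebra_simps)
  also have "\<dots> \<le> 1 - (1 - r) * (u + v)"
  proof -
    have "(1 - r) * v \<le> r * v" using r nonneg by (intro mult_right_mono) auto
    then show ?thesis using mass by (simp add: algebra_simps)
  qed
  finally have "q * (r * P + (1 - r) * Q) \<le> q * (1 - (1 - r) * (u + v))"
    using q by (intro mult_left_mono) auto
  then have \<gamma>1: "(1 - q) + q * (1 - r) * (u + v) \<le> \<gamma>"
    unfolding \<gamma>_def \<alpha>_def \<beta>_def by (simp add: algebra_simps)
  have uv: "0 \<le> u + v" "u + v \<le> 1" using nonneg mass by auto
  have "(1 - q) * (u + v) \<le> (1 - q) * 1" using q uv by (intro mult_left_mono) auto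
  then have \<gamma>2: "(1 - q * r) * (u + v) \<le> \<gamma>" using \<gamma>1 by (simp add: algebra_simps)
  have \<gamma>0: "0 \<le> \<gamma>"
  proof -
    have "0 \<le> q * (1 - r) * (u + v)" using q r uv by auto
    then show ?thesis using \<gamma>1 q by linarith
  qed
  have s1: "\<gamma> + \<alpha> + \<beta> = 1" by (simp add: \<gamma>_def)
  have U_eq: "U - z = \<gamma> * (U - y) + \<alpha> * (U - u) + \<beta> * (U - v)"
  proof -
    have "U = (\<gamma> + \<alpha> + \<beta>) * U" using s1 by simp
    then show ?thesis unfolding z by (simp add: algebra_simps)
  qed
  have parts: "0 \<le> \<gamma> * (U - y)" "0 \<le> \<alpha> * (U - u)" "0 \<le> \<beta> * (U - v)"
    using \<alpha>0 \<beta>0 \<gamma>0 U by auto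
  show "z \<le> U" using U_eq parts by linarith
  fix l d :: real
  assume qr: "q * r < 1" and l: "0 < l" "l \<le> U" and d: "U - d \<le> z" "d \<le> U / 4"
  let ?k = "flux_weight q r m l"
  \<comment> \<open>A small weight of \<open>y\<close> forces \<open>u + v\<close> to be small, and then \<open>z\<close> is far below \<open>U\<close>.\<close>
  have k\<gamma>: "?k \<le> \<gamma>"
  proof (rule ccontr)
    assume "\<not> ?k \<le> \<gamma>"
    then have g: "\<gamma> < (1 - q * r) * l / 4" unfolding flux_weight_def by auto
    then have "(1 - q * r) * (u + v) < (1 - q * r) * (l / 4)" using \<gamma>2 by simp
    then have uvl: "u + v < l / 4" using qr by simp
    have "\<gamma> * y \<le> \<gamma> * 1" using \<gamma>0 nonneg mass by (intro mult_left_mono) auto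
    moreover have "(1 - q * r) * l / 4 \<le> 1 * l / 4"
      using q r l by (intro divide_right_mono mult_right_mono) auto
    moreover have "\<alpha> * u \<le> 1 * u" "\<beta> * v \<le> 1 * v"
      using s1 \<alpha>0 \<beta>0 \<gamma>0 nonneg by (intro mult_right_mono; linarith)+
    ultimately have "z < l / 2" using g uvl unfolding z by linarith
    then show False using d l by linarith
  qed
  \<comment> \<open>The weight of \<open>v\<close> is at most one half, so \<open>u\<close> and \<open>y\<close> cannot both be below \<open>U / 2\<close>.\<close>
  have k\<alpha>: "?k \<le> \<alpha>"
  proof -
    have b2: "\<beta> \<le> 1 / 2"
    proof -
      have "Q \<le> 1" using Q1 nonneg mass by linarith
      then have "(1 - r) * q * Q \<le> (1 - r) * 1 * 1"
        using q r Q0 by (intro mult_mono) auto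
      then have "\<beta> \<le> 1 - r" unfolding \<beta>_def by simp
      then show ?thesis using r by linarith
    qed
    have "U / 2 \<le> u \<or> U / 2 \<le> y"
    proof (rule ccontr)
      assume "\<not> ?thesis"
      then have n: "u < U / 2" "y < U / 2" by auto
      have ga: "\<gamma> + \<alpha> \<ge> 1 / 2" using s1 b2 by linarith
      have "\<gamma> * (U - y) \<ge> \<gamma> * (U / 2)" "\<alpha> * (U - u) \<ge> \<alpha> * (U / 2)"
        using n \<gamma>0 \<alpha>0 by (intro mult_left_mono; linarith)+
      moreover have "\<gamma> * (U - y) > \<gamma> * (U / 2) \<or> \<alpha> * (U - u) > \<alpha> * (U / 2)"
      proof (cases "\<gamma> > 0")
        case True
        then have "\<gamma> * (U - y) > \<gamma> * (U / 2)" using n by (intro mult_strict_left_mono) linarith+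
        then show ?thesis ..
      next
        case False
        then have "\<alpha> > 0" using ga \<gamma>0 by linarith
        then have "\<alpha> * (U - u) > \<alpha> * (U / 2)" using n by (intro mult_strict_left_mono) linarith+
        then show ?thesis ..
      qed
      moreover have "(\<gamma> + \<alpha>) * (U / 2) \<ge> 1 / 2 * (U / 2)"
        using ga l by (intro mult_right_mono) linarith+
      ultimately have "U - z > U / 4"
        using U_eq parts unfolding distrib_right by linarith
      then show False using d by linarith
    qed
    then have "(l / 2) ^ m \<le> P"
    proof
      assume "U / 2 \<le> u"
      then have "(l / 2) ^ m \<le> u ^ m" using l by (intro power_mono) auto
      then show ?thesis using P by linarith
    next
      assume "U / 2 \<le> y"
      then have "(l / 2) ^ m \<le> y ^ m" using l by (intro power_mono) auto
      then show ?thesis using P by linarith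
    qed
    then have "r * q * (l / 2) ^ m \<le> \<alpha>" unfolding \<alpha>_def using q r by (intro mult_left_mono) auto
    then show ?thesis unfolding flux_weight_def by linarith
  qed
  have "?k * (U - y) \<le> \<gamma> * (U - y)" "?k * (U - u) \<le> \<alpha> * (U - u)"
    using k\<gamma> k\<alpha> U by (intro mult_right_mono; linarith)+
  then show "?k * (U - y) \<le> d \<and> ?k * (U - u) \<le> d"
    using U_eq parts d by linarith
qed

text \<open>
  The evolution of one residue class.  It is phrased with distribution functions
  rather than point masses, so that mass bounds are differences of values and no infinite sums occur.
\<close>

locale conservative_scheme =
  fixes m :: nat and q r mass :: real and F :: "nat \<Rightarrow> int \<Rightarrow> real"
  assumes m: "m \<ge> 1" and q: "0 < q" "q \<le> 1" and r: "1 / 2 < r" "r \<le> 1" and qr: "q * r < 1"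
    and mass_le: "mass \<le> 1"
    and F_mono: "\<And>n k. F n (k - 1) \<le> F n k"
    and F_nonneg: "\<And>n k. 0 \<le> F n k"
    and F_le: "\<And>n k. F n k \<le> mass"
    and F_left: "\<And>n \<epsilon>. 0 < \<epsilon> \<Longrightarrow> \<exists>K. \<forall>k\<le>K. F n k \<le> \<epsilon>"
    and F_right: "\<And>n \<epsilon>. 0 < \<epsilon> \<Longrightarrow> \<exists>K. \<forall>k\<ge>K. mass - \<epsilon> \<le> F n k"
    and F_step: "\<And>n k. F (Suc n) k = hj_step m (r * q) ((1 - r) * q) (F n (k - 1)) (F n k) (F n (k + 1))"
begin

definition density :: "nat \<Rightarrow> int \<Rightarrow> real" where "density n k = F n k - F n (k - 1)"

lemma density_nonneg: "0 \<le> density n k"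
  using F_mono[of n k] by (simp add: density_def)

lemma sum_density: "(\<Sum>i\<le>j. density n (k - int i)) = F n k - F n (k - int j - 1)"
proof (induction j)
  case (Suc j)
  have "k - int j - 1 = k - int (Suc j)" by simp
  then show ?case using Suc by (simp only: sum.atMost_Suc density_def)
qed (simp add: density_def)

lemma sum_density_le_one: "(\<Sum>i\<le>j. density n (k - int i)) \<le> 1"
  using F_le[of n k] F_nonneg[of n "k - int j - 1"] mass_le unfolding sum_density by linarith

lemma three_density_le_one: "density n (k - 1) + density n k + density n (k + 1) \<le> 1"
  using sum_density_le_one[where j = 2 and n = n and k = "k + 1"] by (simp add: numeral_2_eq_2 algebra_simps)

lemma density_step:
  "density (Suc n) k = density n k + r * q * (density n (k - 1) ^ Suc m - density n k ^ Suc m)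
     + (1 - r) * q * (density n (k + 1) ^ Suc m - density n k ^ Suc m)"
proof -
  have e: "k - 1 + 1 = k" by simp
  have f: "k + 1 - 1 = k" by simp
  have "density (Suc n) k = hj_step m (r * q) ((1 - r) * q) (F n (k - 1)) (F n k) (F n (k + 1))
      - hj_step m (r * q) ((1 - r) * q) (F n (k - 1 - 1)) (F n (k - 1)) (F n k)"
    unfolding density_def[of "Suc n"] F_step e ..
  then show ?thesis
    unfolding hj_step_def density_def f right_diff_distrib by linarith
qed

lemma density_sup_step:
  assumes "\<And>k. density n k \<le> U"
  shows "density (Suc n) k \<le> U"
  unfolding density_step
  using density_step_convex(1)[OF m q r density_nonneg density_nonneg density_nonneg three_density_le_one assms assms assms] .

lemma density_sup_mono:
  assumes "\<And>k. density n k \<le> U" "n \<le> n'"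
  shows "density n' k \<le> U"
  using assms(2)
proof (induction n' arbitrary: k rule: dec_induct)
  case (step i)
  then show ?case using density_sup_step by blast
qed (rule assms(1))

text \<open>
  Each step backwards in time adds one more site on the left at the price of one factor
  \<open>flux_weight\<close> in the deficiency.
\<close>

lemma near_maximum_spreads:
  assumes sup: "\<And>n' k. n \<le> n' \<Longrightarrow> density n' k \<le> U" and l: "0 < l" "l \<le> 1" "l \<le> U"
    and d: "d \<le> U / 4" "0 \<le> d"
    and top: "U - d * flux_weight q r m l ^ j \<le> density (n + j) k"
  shows "\<forall>i\<le>j. U - d \<le> density n (k - int i)"
  using top
proof (induction j arbitrary: k)
  case (Suc j)
  let ?w = "flux_weight q r m l"
  have w0: "0 < ?w" using flux_weight_pos q r qr l by auto
  have w1: "?w \<le> 1" using flux_weight_le_one q r l by auto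
  have "d * ?w ^ Suc j \<le> d * 1"
    using w0 w1 d by (intro mult_left_mono power_le_one) auto
  then have dj: "d * ?w ^ Suc j \<le> U / 4" using d by linarith
  have sup': "density (n + j) k' \<le> U" for k' by (rule sup) simp
  have "?w * (U - density (n + j) k) \<le> d * ?w ^ Suc j \<and> ?w * (U - density (n + j) (k - 1)) \<le> d * ?w ^ Suc j"
    using density_step_convex(2)[OF m q r density_nonneg density_nonneg density_nonneg three_density_le_one sup' sup' sup' qr l(1,3) _ dj]
      Suc.prems unfolding add_Suc_right density_step .
  then have "?w * (U - density (n + j) k) \<le> ?w * (d * ?w ^ j)"
      "?w * (U - density (n + j) (k - 1)) \<le> ?w * (d * ?w ^ j)" by (simp_all add: mult_ac)
  then have "U - d * ?w ^ j \<le> density (n + j) k" "U - d * ?w ^ j \<le> density (n + j) (k - 1)"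
    using w0 by simp_all
  then have 1: "\<forall>i\<le>j. U - d \<le> density n (k - int i)" and 2: "\<forall>i\<le>j. U - d \<le> density n (k - 1 - int i)"
    using Suc.IH by blast+
  show ?case
  proof (intro allI impI)
    fix i assume "i \<le> Suc j"
    show "U - d \<le> density n (k - int i)"
    proof (cases "i \<le> j")
      case False
      then have "i = Suc j" using \<open>i \<le> Suc j\<close> by simp
      then show ?thesis using 2[rule_format, of j] by (simp add: algebra_simps)
    qed (use 1 in auto)
  qed
qed simp

text \<open>
  A run of \<open>j + 1\<close> sites with mass near a level \<open>l\<close> contradicts total mass \<open>1\<close> as soon as \<open>j\<close> is
  large compared to \<open>1 / l\<close>.  So as long as the maximum exceeds \<open>\<theta>\<close>, it drops within \<open>j\<close> steps by an
  amount \<open>\<delta>\<close> that depends on \<open>\<theta>\<close> alone.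
\<close>

lemma density_eventually_small:
  assumes "0 < \<theta>"
  shows "\<exists>N. \<forall>n\<ge>N. \<forall>k. density n k \<le> \<theta>"
proof -
  define l where "l = min \<theta> 1"
  have l: "0 < l" "l \<le> 1" "l \<le> \<theta>" using assms by (auto simp: l_def)
  obtain j :: nat where j: "4 / (3 * l) < real j" using reals_Archimedean2 by blast
  define \<delta> where "\<delta> = l / 4 * flux_weight q r m l ^ j"
  have \<delta>0: "0 < \<delta>" using flux_weight_pos[OF q(1) _ qr l(1)] r l unfolding \<delta>_def by simp
  have drop: "density (n + j) k \<le> U - \<delta>" if sup: "\<And>k. density n k \<le> U" and U: "l \<le> U" for n k U
  proof (rule ccontr)
    assume "\<not> ?thesis"
    then have "U - l / 4 * flux_weight q r m l ^ j \<le> density (n + j) k" unfolding \<delta>_def by simp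
    then have run: "\<forall>i\<le>j. U - l / 4 \<le> density n (k - int i)"
      using near_maximum_spreads[OF density_sup_mono[OF sup] l(1,2) U] U l by auto
    have "(\<Sum>i\<le>j. 3 / 4 * l) \<le> (\<Sum>i\<le>j. density n (k - int i))"
    proof (rule sum_mono)
      fix i assume "i \<in> {..j}"
      then have "U - l / 4 \<le> density n (k - int i)" using run by simp
      then show "3 / 4 * l \<le> density n (k - int i)" using U by linarith
    qed
    also have "\<dots> \<le> 1" by (rule sum_density_le_one)
    finally have "real (Suc j) * (3 / 4 * l) \<le> 1" by simp
    moreover have "4 / (3 * l) * (3 / 4 * l) < real (Suc j) * (3 / 4 * l)"
      using j l by (intro mult_strict_right_mono) auto
    moreover have "4 / (3 * l) * (3 / 4 * l) = 1" using l by simp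
    ultimately show False by linarith
  qed
  have level: "\<exists>n. \<forall>k. density n k \<le> max \<theta> (1 - real i * \<delta>)" for i
  proof (induction i)
    case 0
    have "density 0 k \<le> 1" for k using sum_density_le_one[of 0 k 0] by simp
    then show ?case by (intro exI[of _ 0]) (auto simp: le_max_iff_disj)
  next
    case (Suc i)
    then obtain n where n: "\<And>k. density n k \<le> max \<theta> (1 - real i * \<delta>)" by blast
    have "density (n + j) k \<le> max \<theta> (1 - real (Suc i) * \<delta>)" for k
    proof -
      have "density (n + j) k \<le> max \<theta> (1 - real i * \<delta>) - \<delta>" using l by (intro drop n) simp
      also have "\<dots> \<le> max \<theta> (1 - real (Suc i) * \<delta>)"
        using \<delta>0 by (auto simp: max_def algebra_simps)
      finally show ?thesis .
    qed
    then show ?case by blast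
  qed
  obtain i :: nat where "1 / \<delta> < real i" using reals_Archimedean2 by blast
  then have "1 < real i * \<delta>" using \<delta>0 by (simp add: divide_simps)
  then have "max \<theta> (1 - real i * \<delta>) = \<theta>" using assms by simp
  then obtain N where "\<And>k. density N k \<le> \<theta>" using level[of i] by auto
  then show ?thesis using density_sup_mono by blast
qed

end

section \<open>The discrete source wave\<close>

declare real_root_ge_zero [simp]

definition root_sum :: "nat \<Rightarrow> nat \<Rightarrow> real" where
  "root_sum m k = (\<Sum>i\<le>k. root m (real i))"

lemma root_sum_0 [simp]: "root_sum m 0 = 0"
  by (simp add: root_sum_def)

lemma root_sum_Suc: "root_sum m (Suc k) = root_sum m k + root m (real (Suc k))"
  by (simp add: root_sum_def)

lemma root_sum_diff: "root_sum m (nat k) - root_sum m (nat (k - 1)) = root m (real (nat k))"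
proof (cases "k \<ge> 1")
  case True
  then have "nat k = Suc (nat (k - 1))" by simp
  then show ?thesis using root_sum_Suc by simp
qed simp

text \<open>
  The inequality between weighted arithmetic and geometric means, as an instance of Bernoulli's inequality.
  With \<open>b\<close> and \<open>c\<close> the \<open>m\<close>-th roots of consecutive integers it is the induction step for
  the two comparisons of \<open>root_sum\<close> with its integral below.
\<close>

lemma weighted_power_mean:
  fixes b c :: real
  assumes "0 \<le> b" "0 \<le> c"
  shows "real (Suc m) * b * c ^ m \<le> b ^ Suc m + real m * c ^ Suc m"
proof (cases "c = 0")
  case True
  then show ?thesis using assms by (cases m) auto
next
  case False
  then have c: "0 < c" using assms by simp
  have "1 + real (Suc m) * (b / c - 1) \<le> (1 + (b / c - 1)) ^ Suc m"
    using assms c by (intro Bernoulli_inequality) simp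
  then have "(1 + real (Suc m) * (b / c - 1)) * c ^ Suc m \<le> (b / c) ^ Suc m * c ^ Suc m"
    using c by (intro mult_right_mono) auto
  also have "\<dots> = b ^ Suc m" using c by (simp only: power_mult_distrib [symmetric]) simp
  also have "(1 + real (Suc m) * (b / c - 1)) * c ^ Suc m
      = real (Suc m) * (b / c * c) * c ^ m - real m * c ^ Suc m"
    by (simp add: algebra_simps)
  finally show ?thesis using c by simp
qed

lemma root_sum_lower:
  assumes "m \<ge> 1"
  shows "real m * (real k * root m (real k)) \<le> real (Suc m) * root_sum m k"
proof (induction k)
  case (Suc k)
  define b c where "b = root m (real (Suc k))" and "c = root m (real k)"
  have bm: "b ^ m = real (Suc k)" "c ^ m = real k" using assms by (simp_all add: b_def c_def)
  have nn: "0 \<le> b" "0 \<le> c" by (simp_all add: b_def c_def)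
  have "real (Suc m) * b * c ^ m \<le> b * b ^ m + real m * (c * c ^ m)"
    using weighted_power_mean[OF nn] by simp
  then have "real (Suc m) * b * real k \<le> b * real (Suc k) + real m * (c * real k)"
    unfolding bm .
  then show ?case using Suc unfolding root_sum_Suc b_def [symmetric] c_def [symmetric]
    by (simp add: algebra_simps)
qed simp

lemma root_sum_upper:
  assumes "m \<ge> 1"
  shows "real (Suc m) * root_sum m k \<le> real m * (real (Suc k) * root m (real (Suc k)))"
proof (induction k)
  case (Suc k)
  define b c where "b = root m (real (Suc (Suc k)))" and "c = root m (real (Suc k))"
  have bm: "b ^ m = real (Suc (Suc k))" "c ^ m = real (Suc k)" using assms by (simp_all add: b_def c_def)
  have nn: "0 \<le> b" "0 \<le> c" by (simp_all add: b_def c_def)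
  have "real (Suc m) * c * b ^ m \<le> c * c ^ m + real m * (b * b ^ m)"
    using weighted_power_mean[OF nn(2,1)] by simp
  then have "real (Suc m) * c * real (Suc (Suc k)) \<le> c * real (Suc k) + real m * (b * real (Suc (Suc k)))"
    unfolding bm .
  then show ?case using Suc unfolding root_sum_Suc b_def [symmetric] c_def [symmetric]
    by (simp add: algebra_simps)
qed simp

lemma root_decay:
  assumes n: "n \<ge> 1" and t: "t \<ge> (1::nat)" and l: "0 \<le> l"
  shows "root n (l / real t) / (real n * real (Suc t)) \<le> root n (l / real t) - root n (l / real (Suc t))"
    and "root n (l / real t) - root n (l / real (Suc t)) \<le> root n (l / real t) / (real n * real t)"
proof -
  define x where "x = root n (real t / real (Suc t))"
  have x: "0 < x" "x \<le> 1" using n t by (auto simp: x_def)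
  have xn: "x ^ n = real t / real (Suc t)" using n by (simp add: x_def)
  have eq: "root n (l / real (Suc t)) = root n (l / real t) * x"
    unfolding x_def real_root_mult [symmetric] using t by simp
  have k0: "0 \<le> root n (l / real t)" using l by simp
  have "1 + real n * (x - 1) \<le> (1 + (x - 1)) ^ n" using x by (intro Bernoulli_inequality) simp
  then have "real n * (1 - x) \<ge> 1 - x ^ n" by (simp add: algebra_simps)
  moreover have "1 - x ^ n = 1 / real (Suc t)" unfolding xn by (simp add: field_simps)
  ultimately have "1 / real (Suc t) \<le> (1 - x) * real n" by (simp add: mult.commute)
  then have "1 / real (Suc t) / real n \<le> 1 - x"
    using n by (subst pos_divide_le_eq) auto
  then have "1 / (real n * real (Suc t)) \<le> 1 - x" by (simp add: mult.commute)
  from mult_left_mono[OF this k0]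
  show "root n (l / real t) / (real n * real (Suc t)) \<le> root n (l / real t) - root n (l / real (Suc t))"
    unfolding eq by (simp add: algebra_simps)
  have "1 + real n * (1 / x - 1) \<le> (1 + (1 / x - 1)) ^ n" using x by (intro Bernoulli_inequality) simp
  also have "\<dots> = 1 + 1 / real t" using t by (simp add: power_one_over xn field_simps)
  finally have "real n * (1 / x - 1) * x \<le> 1 / real t * x" using x by (intro mult_right_mono) auto
  also have "\<dots> \<le> 1 / real t" using x t by (simp add: divide_right_mono)
  also have "real n * (1 / x - 1) * x = real n * (1 - x)" using x by (simp add: left_diff_distrib mult.assoc)
  finally have "real n * (1 - x) \<le> 1 / real t" .
  then have "1 - x \<le> 1 / (real n * real t)" using n t by (simp add: field_simps)
  from mult_left_mono[OF this k0]
  show "root n (l / real t) - root n (l / real (Suc t)) \<le> root n (l / real t) / (real n * real t)"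
    unfolding eq by (simp add: algebra_simps)
qed

lemma root_Suc_le:
  assumes "m \<ge> 1" "k \<ge> (1::nat)"
  shows "root m (real (Suc k)) \<le> (1 + 1 / real k) * root m (real k)"
proof -
  have "root m (1 + 1 / real k) \<le> root m ((1 + 1 / real k) ^ m)"
    using assms self_le_power[of "1 + 1 / real k" m] by (intro real_root_le_mono) auto
  also have "\<dots> = 1 + 1 / real k" using assms by (intro real_root_power_cancel) auto
  finally have "root m (1 + 1 / real k) * root m (real k) \<le> (1 + 1 / real k) * root m (real k)"
    by (intro mult_right_mono) auto
  moreover have "real (Suc k) = (1 + 1 / real k) * real k" using assms by (simp add: field_simps)
  ultimately show ?thesis by (simp only: real_root_mult)
qed

text \<open>
  A strict inequality between the coefficients absorbs the shift by one site for all large \<open>k\<close>, since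
  the ratio of consecutive values tends to \<open>1\<close>; the constant \<open>C\<close> pays for the finitely many others.
\<close>

lemma shifted_power_dominated:
  assumes m: "m \<ge> 1" and A: "0 < A" "A < B"
  shows "\<exists>C\<ge>0. \<forall>k. A * (real (Suc k) * root m (real (Suc k))) \<le> B * (real k * root m (real k)) + C"
proof -
  have "(\<lambda>k. (1 + 1 / real k) ^ 2) \<longlonglongrightarrow> (1 + 0) ^ 2"
    by (intro tendsto_intros lim_1_over_n)
  then have "eventually (\<lambda>k. (1 + 1 / real k) ^ 2 < B / A) sequentially"
    by (rule order_tendstoD) (use A in simp)
  then obtain K where K: "\<And>k. k \<ge> K \<Longrightarrow> (1 + 1 / real k) ^ 2 < B / A"
    unfolding eventually_sequentially by blast
  define C where "C = A * (real (Suc (Suc K)) * root m (real (Suc (Suc K))))"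
  have "A * (real (Suc k) * root m (real (Suc k))) \<le> B * (real k * root m (real k)) + C" for k
  proof (cases "k \<ge> Suc K")
    case True
    then have k: "k \<ge> 1" "k \<ge> K" by auto
    have "real (Suc k) * root m (real (Suc k))
        \<le> ((1 + 1 / real k) * real k) * ((1 + 1 / real k) * root m (real k))"
      using k root_Suc_le[OF m k(1)] by (intro mult_mono) (auto simp: field_simps)
    also have "\<dots> = (1 + 1 / real k) ^ 2 * (real k * root m (real k))"
      by (simp add: power2_eq_square)
    also have "\<dots> \<le> B / A * (real k * root m (real k))"
      using K[OF k(2)] by (intro mult_right_mono) auto
    finally have "A * (real (Suc k) * root m (real (Suc k))) \<le> A * (B / A * (real k * root m (real k)))"
      using A by (intro mult_left_mono) auto
    also have "\<dots> = B * (real k * root m (real k))" using A by simp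
    moreover have "0 \<le> C" using A by (simp add: C_def)
    ultimately show ?thesis by linarith
  next
    case False
    then have "A * (real (Suc k) * root m (real (Suc k))) \<le> C"
      unfolding C_def using A m by (intro mult_left_mono mult_mono) auto
    moreover have "0 \<le> B * (real k * root m (real k))" using A by simp
    ultimately show ?thesis by linarith
  qed
  moreover have "0 \<le> C" using A by (simp add: C_def)
  ultimately show ?thesis by blast
qed

text \<open>
  Chosen such that the increment at site \<open>k\<close> is the \<open>m\<close>-th root of \<open>l * k / t\<close>, the discrete form of the
  rarefaction fan \<open>(l * x / t) powr (1 / m)\<close>.  The fan solves
  \<open>u\<^sub>t + \<sigma> (u ^ (m + 1))\<^sub>x = 0\<close> exactly if \<open>l * \<sigma> * (m + 1) = 1\<close>.  A larger \<open>l\<close> makes the wave decay too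
  slowly for its flux and hence a supersolution, a smaller \<open>l\<close> makes it a subsolution.
\<close>

definition source_wave :: "nat \<Rightarrow> real \<Rightarrow> nat \<Rightarrow> int \<Rightarrow> real" where
  "source_wave m l t k = root m (l / real t) * root_sum m (nat k)"

lemma source_wave_nonpos [simp]: "k \<le> 0 \<Longrightarrow> source_wave m l t k = 0"
  by (simp add: source_wave_def)

lemma source_wave_diff:
  "source_wave m l t k - source_wave m l t (k - 1) = root m (l / real t) * root m (real (nat k))"
  unfolding source_wave_def right_diff_distrib [symmetric] root_sum_diff ..

lemma root_sum_nonneg: "0 \<le> root_sum m k"
  unfolding root_sum_def by (intro sum_nonneg) auto

lemma source_wave_nonneg: "0 \<le> l \<Longrightarrow> 0 \<le> source_wave m l t k"
  unfolding source_wave_def by (intro mult_nonneg_nonneg root_sum_nonneg) auto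

lemma root_sum_mono: "j \<le> k \<Longrightarrow> root_sum m j \<le> root_sum m k"
  unfolding root_sum_def by (intro sum_mono2) auto

lemma source_wave_mono: "0 \<le> l \<Longrightarrow> j \<le> k \<Longrightarrow> source_wave m l t j \<le> source_wave m l t k"
  unfolding source_wave_def by (intro mult_left_mono root_sum_mono nat_mono) auto

lemma root_scale_antimono:
  assumes "m \<ge> 1" "0 \<le> l" "1 \<le> s" "s \<le> (t::nat)"
  shows "root m (l / real t) \<le> root m (l / real s)"
  using assms by (intro real_root_le_mono divide_left_mono) auto

lemma source_wave_antimono_time:
  assumes "m \<ge> 1" "0 \<le> l" "1 \<le> s" "s \<le> (t::nat)"
  shows "source_wave m l t k \<le> source_wave m l s k"
  unfolding source_wave_def using assms
  by (intro mult_right_mono root_scale_antimono root_sum_nonneg) auto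

text \<open>
  The flux at site \<open>j\<close> is \<open>root m (l / t) / t\<close> times a function of \<open>j\<close>.  The time derivative of the wave has
  the same prefactor, so that comparing the two leaves an inequality in \<open>j\<close> alone.
\<close>

lemma slope_power_Suc:
  assumes "m \<ge> 1" "0 \<le> l"
  shows "(root m (l / real t) * root m (real j)) ^ Suc m
     = root m (l / real t) / real t * (l * (real j * root m (real j)))"
proof -
  have "root m (l / real t) ^ m = l / real t" "root m (real j) ^ m = real j"
    using assms by auto
  then show ?thesis by (simp add: power_mult_distrib)
qed

text \<open>
  Where the wave has not yet reached height \<open>1\<close>, site \<open>k\<close> lies at distance at most of order \<open>t powr (1 / (m + 1))\<close> and the
  slope at most of order \<open>t powr (- 1 / (m + 1))\<close>.  In the proof, \<open>y\<close> is the slope one site further left and one time step later,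
  which costs a factor \<open>2\<close> each.
\<close>

lemma slope_behind_front:
  assumes m: "m \<ge> 1" and l: "0 < l" and t: "2 \<le> t" "l \<le> real t"
    and front: "source_wave m l (Suc t) k \<le> 1"
  shows "(root m (l / real t) * root m (real (nat (k + 1)))) ^ Suc m \<le> 4 ^ Suc m * (2 * l) / real t"
proof -
  define c c' where "c = root m (l / real t)" and "c' = root m (l / real (Suc t))"
  have c0: "0 \<le> c" "0 \<le> c'" using l by (simp_all add: c_def c'_def)
  show ?thesis
  proof (cases "k \<le> 0")
    case True
    have "nat (k + 1) \<le> 1" using True by simp
    then have "root m (real (nat (k + 1))) \<le> root m 1" using m by (intro real_root_le_mono) auto
    then have "c * root m (real (nat (k + 1))) \<le> c * 1" using m c0 by (intro mult_left_mono) auto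
    then have "(c * root m (real (nat (k + 1)))) ^ Suc m \<le> c ^ Suc m"
      using c0 by (intro power_mono) auto
    also have "c ^ Suc m = c * (l / real t)" using m l by (simp add: c_def)
    also have "\<dots> \<le> 1 * (l / real t)"
    proof (rule mult_right_mono)
      have "l / real t \<le> 1" using l t by simp
      then have "c \<le> root m 1" unfolding c_def using m by (intro real_root_le_mono) auto
      then show "c \<le> 1" using m by simp
    qed (use l in auto)
    also have "\<dots> \<le> 4 ^ Suc m * (2 * l) / real t"
    proof -
      have "1 * l \<le> 4 ^ Suc m * (2 * l)"
        using l one_le_power[of "4::real" "Suc m"] by (intro mult_mono) auto
      then show ?thesis by (simp add: divide_right_mono)
    qed
    finally show ?thesis unfolding c_def .
  next
    case False
    define j where "j = nat k"
    have j: "j \<ge> 1" "nat (k + 1) = Suc j" using False by (auto simp: j_def)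
    define y where "y = c' * root m (real j)"
    have y0: "0 \<le> y" using c0 by (simp add: y_def)
    have "c - c' \<le> c / (real m * real t)"
      unfolding c_def c'_def using root_decay(2)[of m t l] m l t by simp
    also have "\<dots> \<le> c / 2"
    proof (rule divide_left_mono)
      have "1 * 2 \<le> real m * real t" using m t by (intro mult_mono) auto
      then show "2 \<le> real m * real t" by simp
    qed (use c0 m t in auto)
    finally have cc: "c \<le> 2 * c'" by simp
    have "root m (real (Suc j)) \<le> (1 + 1 / real j) * root m (real j)" by (rule root_Suc_le[OF m j(1)])
    also have "\<dots> \<le> 2 * root m (real j)" using j by (intro mult_right_mono) auto
    finally have "c * root m (real (Suc j)) \<le> (2 * c') * (2 * root m (real j))"
      using cc c0 by (intro mult_mono) auto
    then have le: "c * root m (real (Suc j)) \<le> 4 * y" by (simp add: y_def)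
    have "real m * (real j * root m (real j)) \<le> real (Suc m) * root_sum m j"
      by (rule root_sum_lower[OF m])
    also have "\<dots> \<le> 2 * real m * root_sum m j"
      using m by (intro mult_right_mono root_sum_nonneg) auto
    finally have "real j * root m (real j) \<le> 2 * root_sum m j" using m by simp
    then have "c' * (real j * root m (real j)) \<le> c' * (2 * root_sum m j)"
      using c0 by (intro mult_left_mono) auto
    also have "\<dots> \<le> 2" using front unfolding source_wave_def c'_def j_def by simp
    finally have yj: "c' * (real j * root m (real j)) \<le> 2" .
    have "y ^ Suc m = (c' * (real j * root m (real j))) * (l / real (Suc t))"
      unfolding y_def c'_def using slope_power_Suc[OF m, of l "Suc t" j] l by simp
    also have "\<dots> \<le> 2 * (l / real (Suc t))" using yj l by (intro mult_right_mono) auto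
    also have "\<dots> \<le> 2 * (l / real t)"
      using l t by (intro mult_left_mono divide_left_mono) auto
    finally have "y ^ Suc m \<le> 2 * l / real t" by simp
    then have "(4 * y) ^ Suc m \<le> 4 ^ Suc m * (2 * l / real t)"
      unfolding power_mult_distrib by (intro mult_left_mono) auto
    moreover have "(c * root m (real (Suc j))) ^ Suc m \<le> (4 * y) ^ Suc m"
      using le c0 by (intro power_mono) auto
    ultimately show ?thesis unfolding j(2) c_def by simp
  qed
qed

section \<open>A concave smoothing of the minimum\<close>

definition soft_slope :: "real \<Rightarrow> real \<Rightarrow> real \<Rightarrow> real" where
  "soft_slope w M y = max 0 (min 1 ((M - y) / w))"

text \<open>
  The concave function with derivative \<open>soft_slope\<close>: it is the identity below \<open>M - w\<close>, constant above \<open>M\<close>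
  and quadratic in between.  It is written in terms of its own slope \<open>s\<close> because it is the minimum over all
  slopes \<open>s\<close> in the unit interval of the displayed affine functions of \<open>y\<close>.  In this form concavity (\<open>soft_min_tangent\<close>) comes
  without any differentiation.
\<close>

definition soft_min :: "real \<Rightarrow> real \<Rightarrow> real \<Rightarrow> real" where
  "soft_min w M y = (let s = soft_slope w M y in s * y + (1 - s) * M - w * (1 - s ^ 2) / 2)"

context
  fixes w M :: real
  assumes w: "0 < w"
begin

lemma soft_slope_bounds: "0 \<le> soft_slope w M y" "soft_slope w M y \<le> 1"
  by (auto simp: soft_slope_def)

lemma soft_min_le_line:
  assumes "0 \<le> p" "p \<le> 1"
  shows "soft_min w M y \<le> p * y + (1 - p) * M - w * (1 - p ^ 2) / 2"
proof -
  define s where "s = soft_slope w M y"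
  have "0 \<le> (p - s) * (y - M + w * s)"
  proof -
    consider "M \<le> y" | "y \<le> M - w" | "M - w < y" "y < M" by linarith
    then show ?thesis
    proof cases
      case 1
      then have "s = 0" using w by (simp add: s_def soft_slope_def max_def divide_simps)
      then show ?thesis using 1 assms by simp
    next
      case 2
      then have "s = 1" using w by (simp add: s_def soft_slope_def max_def min_def divide_simps)
      then show ?thesis using 2 assms by (simp add: mult_nonpos_nonpos)
    next
      case 3
      then have "s = (M - y) / w" using w by (simp add: s_def soft_slope_def divide_simps)
      then show ?thesis using w by simp
    qed
  qed
  moreover have "0 \<le> w * (p - s) ^ 2 / 2" using w by simp
  moreover have "(p * y + (1 - p) * M - w * (1 - p ^ 2) / 2) - (s * y + (1 - s) * M - w * (1 - s ^ 2) / 2)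
      = (p - s) * (y - M + w * s) + w * (p - s) ^ 2 / 2"
    by (simp add: field_simps power2_eq_square)
  ultimately show ?thesis unfolding soft_min_def Let_def s_def [symmetric] by linarith
qed

lemma soft_min_tangent: "soft_min w M x \<le> soft_min w M y + soft_slope w M y * (x - y)"
proof -
  define s where "s = soft_slope w M y"
  have "soft_min w M x \<le> s * x + (1 - s) * M - w * (1 - s ^ 2) / 2"
    unfolding s_def by (rule soft_min_le_line[OF soft_slope_bounds])
  also have "\<dots> = (s * y + (1 - s) * M - w * (1 - s ^ 2) / 2) + s * (x - y)"
    by (simp add: algebra_simps)
  finally show ?thesis by (simp add: soft_min_def Let_def s_def)
qed

lemma soft_min_mono:
  assumes "x \<le> y"
  shows "soft_min w M x \<le> soft_min w M y"
proof -
  have "soft_slope w M y * (x - y) \<le> 0"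
    using assms soft_slope_bounds by (intro mult_nonneg_nonpos) auto
  then show ?thesis using soft_min_tangent[of x y] by linarith
qed

lemma soft_min_le: "soft_min w M y \<le> M"
  using soft_min_le_line[of 0 y] w by simp

lemma soft_min_ge: "min y M - w \<le> soft_min w M y"
proof -
  define s where "s = soft_slope w M y"
  have s: "0 \<le> s" "s \<le> 1" using soft_slope_bounds by (auto simp: s_def)
  have "s * min y M + (1 - s) * min y M \<le> s * y + (1 - s) * M"
    using s by (intro add_mono mult_left_mono) auto
  moreover have "s * min y M + (1 - s) * min y M = min y M" by (simp add: algebra_simps)
  moreover have "w * (1 - s ^ 2) \<le> w * 1" using w by (intro mult_left_mono) auto
  then have "w * (1 - s ^ 2) / 2 \<le> w" using w by linarith
  ultimately show ?thesis unfolding soft_min_def Let_def s_def [symmetric] by linarith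
qed

lemma soft_min_zero: "w \<le> M \<Longrightarrow> soft_min w M 0 = 0"
  using w by (simp add: soft_min_def soft_slope_def Let_def)

lemma soft_slope_eq_0: "M \<le> y \<Longrightarrow> soft_slope w M y = 0"
  using w by (simp add: soft_slope_def max_def min_def divide_simps)

lemma soft_slope_lipschitz:
  assumes "x \<le> y"
  shows "soft_slope w M x - soft_slope w M y \<le> (y - x) / w"
proof -
  have "(M - x) / w = (M - y) / w + (y - x) / w" using w by (simp add: field_simps)
  moreover have "0 \<le> (y - x) / w" using w assms by simp
  ultimately show ?thesis unfolding soft_slope_def by linarith
qed

end

section \<open>The barrier from above\<close>

lemma root_scale_tendsto_0:
  assumes "m \<ge> 1"
  shows "(\<lambda>t. root m (l / real t)) \<longlonglongrightarrow> 0"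
proof -
  have "(\<lambda>t. root m (l * (1 / real t))) \<longlonglongrightarrow> root m (l * 0)"
    by (intro tendsto_intros lim_1_over_n)
  then show ?thesis using assms by simp
qed

lemma eventually_const_over_le:
  fixes c d :: real
  assumes "0 < d"
  shows "eventually (\<lambda>t. c / real t \<le> d) sequentially"
proof -
  have "(\<lambda>t. c * (1 / real t)) \<longlonglongrightarrow> c * 0" by (intro tendsto_intros lim_1_over_n)
  then have "eventually (\<lambda>t. c * (1 / real t) < d) sequentially"
    by (rule order_tendstoD) (use assms in simp)
  then show ?thesis by eventually_elim simp
qed

context conservative_scheme
begin

definition drift :: real where "drift = (2 * r - 1) * q"

lemma drift_pos: "0 < drift"
  unfolding drift_def using q r by simp

abbreviation update :: "real \<Rightarrow> real \<Rightarrow> real \<Rightarrow> real" where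
  "update \<equiv> hj_step m (r * q) ((1 - r) * q)"

lemma update_mono:
  assumes "real (Suc m) * \<theta> ^ m \<le> 1" "0 \<le> \<theta>"
    and "x \<le> x'" "y \<le> y'" "z \<le> z'"
    and "x \<le> y" "y \<le> z" "z - y \<le> \<theta>" "x' \<le> y'" "y' \<le> z'" "y' - x' \<le> \<theta>"
  shows "update x y z \<le> update x' y' z'"
proof (rule hj_step_mono[where \<theta> = \<theta>])
  have "r * q + (1 - r) * q = q" by (simp add: algebra_simps)
  moreover have "q * (real (Suc m) * \<theta> ^ m) \<le> 1 * 1" using q assms by (intro mult_mono) auto
  ultimately show "(r * q + (1 - r) * q) * (real (Suc m) * \<theta> ^ m) \<le> 1" by simp
qed (use assms q r in auto)

text \<open>
  Below such a threshold \<open>\<theta>\<close> the update is monotone.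
\<close>

lemma slope_threshold: "\<exists>\<theta>>0. real (Suc m) * \<theta> ^ m \<le> 1"
proof -
  define \<theta> where "\<theta> = 1 / real (Suc m)"
  have "\<theta> ^ m \<le> \<theta>" using power_decreasing[of 1 m \<theta>] m by (simp add: \<theta>_def)
  then have "real (Suc m) * \<theta> ^ m \<le> real (Suc m) * \<theta>" by (intro mult_left_mono) auto
  also have "\<dots> = 1" by (simp add: \<theta>_def)
  finally show ?thesis by (intro exI[of _ \<theta>]) (simp add: \<theta>_def)
qed

text \<open>
  After division by the common prefactor the flux has the leading coefficient \<open>l * \<sigma>\<close> and the decay
  of the wave has \<open>1 / (m + 1)\<close>.  That the former is strictly larger leaves room for replacing
  \<open>k\<close> by \<open>k + 1\<close> in the other terms.  The remaining error is a constant times \<open>root m (l / t) / t\<close>, bounded by a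
  multiple of the decrease of \<open>root m (l / t)\<close> and therefore telescoping.
\<close>

lemma steep_wave_supersolution:
  assumes l: "0 < l" "1 < l * drift * real (Suc m)"
  shows "\<exists>C\<ge>0. \<forall>t\<ge>1. \<forall>k. update (source_wave m l t (k - 1)) (source_wave m l t k) (source_wave m l t (k + 1))
      \<le> source_wave m l (Suc t) k + C * (root m (l / real t) - root m (l / real (Suc t)))"
proof -
  define A where "A = 1 / real (Suc m) + (1 - r) * q * l"
  have A0: "0 < A" unfolding A_def using q r l by (intro add_pos_nonneg) auto
  have "1 / real (Suc m) < l * drift" using l by (simp add: field_simps)
  then have AB: "A < r * q * l" unfolding A_def drift_def by (simp add: algebra_simps)
  obtain C0 where C0: "0 \<le> C0"
      "\<And>k. A * (real (Suc k) * root m (real (Suc k))) \<le> r * q * l * (real k * root m (real k)) + C0"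
    using shifted_power_dominated[OF m A0 AB] by blast
  have "update (source_wave m l t (k - 1)) (source_wave m l t k) (source_wave m l t (k + 1))
      \<le> source_wave m l (Suc t) k + 2 * real m * C0 * (root m (l / real t) - root m (l / real (Suc t)))"
    if t: "t \<ge> 1" for t k
  proof -
    define c c' where "c = root m (l / real t)" and "c' = root m (l / real (Suc t))"
    have c0: "0 \<le> c" "0 \<le> c'" using l by (simp_all add: c_def c'_def)
    define j where "j = nat k"
    define J where "J = real (Suc j) * root m (real (Suc j))"
    have J0: "0 \<le> J" by (simp add: J_def)
    have mpos: "0 < real m" using m by simp
    have factor: "s - r * q * (d * (l * Y)) + (1 - r) * q * (d * (l * Z))
        = s + d * ((1 - r) * q * l * Z - r * q * l * Y)" for s d Y Z :: real
      by (simp add: algebra_simps)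
    have "nat (k + 1) \<le> Suc j" by (simp add: j_def)
    then have "real (nat (k + 1)) * root m (real (nat (k + 1))) \<le> J"
      unfolding J_def using m by (intro mult_mono) auto
    then have b1: "(c * root m (real (nat (k + 1)))) ^ Suc m \<le> c / real t * (l * J)"
      unfolding c_def slope_power_Suc[OF m less_imp_le[OF l(1)]]
      using l by (intro mult_left_mono) auto
    have "update (source_wave m l t (k - 1)) (source_wave m l t k) (source_wave m l t (k + 1))
      = source_wave m l t k - r * q * (c * root m (real j)) ^ Suc m
        + (1 - r) * q * (c * root m (real (nat (k + 1)))) ^ Suc m"
      unfolding hj_step_def source_wave_diff
      using source_wave_diff[of m l t "k + 1"] by (simp add: c_def j_def)
    also have "\<dots> \<le> source_wave m l t k - r * q * (c / real t * (l * (real j * root m (real j))))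
        + (1 - r) * q * (c / real t * (l * J))"
    proof -
      have "(1 - r) * q * (c * root m (real (nat (k + 1)))) ^ Suc m \<le> (1 - r) * q * (c / real t * (l * J))"
        using b1 q r by (intro mult_left_mono) auto
      moreover have "(c * root m (real j)) ^ Suc m = c / real t * (l * (real j * root m (real j)))"
        unfolding c_def using slope_power_Suc[OF m] l by simp
      ultimately show ?thesis by simp
    qed
    finally have 1: "update (source_wave m l t (k - 1)) (source_wave m l t k) (source_wave m l t (k + 1))
      \<le> source_wave m l t k + c / real t * ((1 - r) * q * l * J - r * q * l * (real j * root m (real j)))"
      unfolding factor .
    have 2: "source_wave m l t k - source_wave m l (Suc t) k \<le> c / real t * (J / real (Suc m))"
    proof -
      have S: "root_sum m j \<le> real m * (J / real (Suc m))"
        using root_sum_upper[OF m, of j] by (simp add: J_def field_simps)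
      have "source_wave m l t k - source_wave m l (Suc t) k = (c - c') * root_sum m j"
        unfolding source_wave_def c_def c'_def j_def by (simp add: algebra_simps)
      also have "\<dots> \<le> (c / (real m * real t)) * root_sum m j"
        unfolding c_def c'_def using root_decay(2)[of m t l] m t l
        by (intro mult_right_mono root_sum_nonneg) auto
      also have "\<dots> \<le> (c / (real m * real t)) * (real m * (J / real (Suc m)))"
        using S c0 m by (intro mult_left_mono) auto
      also have "\<dots> = c / real t * (J / real (Suc m))" using mpos by simp
      finally show ?thesis .
    qed
    have 3: "c / real t * C0 \<le> 2 * real m * C0 * (c - c')"
    proof -
      have "c / (real m * real (Suc t)) \<le> c - c'"
        unfolding c_def c'_def using root_decay(1)[of m t l] m t l by simp
      moreover have "c / (2 * (real m * real t)) \<le> c / (real m * real (Suc t))"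
      proof (rule divide_left_mono)
        have "real m * real (Suc t) \<le> real m * (2 * real t)" using t by (intro mult_left_mono) auto
        then show "real m * real (Suc t) \<le> 2 * (real m * real t)" by simp
      qed (use c0 m t in auto)
      ultimately have "2 * real m * C0 * (c / (2 * (real m * real t))) \<le> 2 * real m * C0 * (c - c')"
        using C0 by (intro mult_left_mono) auto
      moreover have "2 * real m * C0 * (c / (2 * (real m * real t))) = c / real t * C0"
        using mpos by simp
      ultimately show ?thesis by linarith
    qed
    have "J / real (Suc m) + (1 - r) * q * l * J - r * q * l * (real j * root m (real j)) \<le> C0"
      using C0(2)[of j] unfolding A_def J_def [symmetric] by (simp add: algebra_simps)
    then have "c / real t * (J / real (Suc m) + (1 - r) * q * l * J - r * q * l * (real j * root m (real j)))
        \<le> c / real t * C0"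
      using c0 by (intro mult_left_mono) auto
    then have 4: "c / real t * (J / real (Suc m))
        + c / real t * ((1 - r) * q * l * J - r * q * l * (real j * root m (real j))) \<le> c / real t * C0"
      by (simp add: algebra_simps)
    show ?thesis using 1 2 3 4 unfolding c_def c'_def by linarith
  qed
  moreover have "0 \<le> 2 * real m * C0" using C0 by simp
  ultimately show ?thesis by blast
qed

text \<open>
  The barrier is started at a late time \<open>T\<close>, so that the telescoping errors stay below \<open>\<epsilon> / 2\<close>, and is
  shifted to the left by \<open>L\<close> until it lies above \<open>F N\<close>.  Where the wave exceeds \<open>1\<close> the bound
  is trivial; elsewhere the slopes of both functions are below the threshold and the update is monotone.
\<close>

lemma upper_barrier:
  assumes l: "0 < l" "1 < l * drift * real (Suc m)" and \<epsilon>: "0 < \<epsilon>"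
  shows "\<exists>N T L. \<forall>n k. F (N + n) k \<le> source_wave m l (T + n) (k + L) + \<epsilon>"
proof -
  obtain \<theta> where \<theta>: "0 < \<theta>" "real (Suc m) * \<theta> ^ m \<le> 1" using slope_threshold by blast
  obtain N where N: "\<And>n k. n \<ge> N \<Longrightarrow> density n k \<le> \<theta>" using density_eventually_small[OF \<theta>(1)] by blast
  obtain C where C: "0 \<le> C" "\<And>t k. t \<ge> 1 \<Longrightarrow>
      update (source_wave m l t (k - 1)) (source_wave m l t k) (source_wave m l t (k + 1))
      \<le> source_wave m l (Suc t) k + C * (root m (l / real t) - root m (l / real (Suc t)))"
    using steep_wave_supersolution[OF l] by blast
  have "(\<lambda>t. C * root m (l / real t)) \<longlonglongrightarrow> C * 0"
    by (intro tendsto_intros root_scale_tendsto_0 m)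
  then have "eventually (\<lambda>t. C * root m (l / real t) < \<epsilon> / 2) sequentially"
    by (rule order_tendstoD) (use \<epsilon> in simp)
  moreover have "eventually (\<lambda>t. 4 ^ Suc m * (2 * l) / real t \<le> \<theta> ^ Suc m) sequentially"
    using \<theta> by (intro eventually_const_over_le) auto
  moreover have "eventually (\<lambda>t. l / real t \<le> 1) sequentially"
    by (intro eventually_const_over_le) auto
  moreover have "eventually (\<lambda>t. 2 \<le> t) sequentially" by (rule eventually_ge_at_top)
  ultimately have "eventually (\<lambda>t. C * root m (l / real t) < \<epsilon> / 2 \<and>
      4 ^ Suc m * (2 * l) / real t \<le> \<theta> ^ Suc m \<and> l / real t \<le> 1 \<and> 2 \<le> t) sequentially"
    by eventually_elim simp
  then obtain T where T: "\<And>t. t \<ge> T \<Longrightarrow> C * root m (l / real t) < \<epsilon> / 2 \<and>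
      4 ^ Suc m * (2 * l) / real t \<le> \<theta> ^ Suc m \<and> l / real t \<le> 1 \<and> 2 \<le> t"
    unfolding eventually_sequentially by blast
  obtain K where K: "\<And>k. k \<le> K \<Longrightarrow> F N k \<le> \<epsilon> / 2" using F_left[of "\<epsilon> / 2" N] \<epsilon> by auto
  have cT: "0 < root m (l / real T)" using T[of T] m l by auto
  obtain J :: nat where J: "1 / root m (l / real T) < real J" using reals_Archimedean2 by blast
  have SJ: "1 \<le> root m (l / real T) * root_sum m J"
  proof -
    have "real (card {1..J}) * 1 \<le> (\<Sum>i\<in>{1..J}. root m (real i))"
      using m by (intro sum_bounded_below) auto
    also have "\<dots> \<le> root_sum m J" unfolding root_sum_def by (intro sum_mono2) auto
    finally have "real J \<le> root_sum m J" by simp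
    then have "1 / root m (l / real T) \<le> root_sum m J" using J by linarith
    then show ?thesis using cT by (simp add: divide_simps mult.commute)
  qed
  define L where "L = int J - K"
  define e where "e n = C * (root m (l / real T) - root m (l / real (T + n))) + \<epsilon> / 2" for n
  have e: "\<epsilon> / 2 \<le> e n" "e n \<le> \<epsilon>" for n
  proof -
    have T1: "1 \<le> T" using T[of T] by simp
    have "root m (l / real (T + n)) \<le> root m (l / real T)"
      using T1 l m by (intro root_scale_antimono) auto
    then show "\<epsilon> / 2 \<le> e n" unfolding e_def using C by simp
    have "0 \<le> C * root m (l / real (T + n))" using C l by simp
    moreover have "C * root m (l / real T) < \<epsilon> / 2" using T by blast
    ultimately show "e n \<le> \<epsilon>" unfolding e_def right_diff_distrib by linarith
  qed
  have "F (N + n) k \<le> source_wave m l (T + n) (k + L) + e n" for n k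
  proof (induction n arbitrary: k)
    case 0
    show ?case
    proof (cases "k \<le> K")
      case True
      then show ?thesis using K[of k] e(1)[of 0] source_wave_nonneg[of l m "T + 0" "k + L"] l by simp
    next
      case False
      then have "J \<le> nat (k + L)" by (simp add: L_def)
      then have "root m (l / real T) * root_sum m J \<le> source_wave m l T (k + L)"
        unfolding source_wave_def using cT by (intro mult_left_mono root_sum_mono) auto
      then show ?thesis using SJ F_le[of N k] mass_le e(1)[of 0] \<epsilon> by simp
    qed
  next
    case (Suc n)
    define t where "t = T + n"
    have t: "t \<ge> T" "2 \<le> t" "l \<le> real t" "4 ^ Suc m * (2 * l) / real t \<le> \<theta> ^ Suc m"
      using T[of t] by (auto simp: t_def)
    show ?case
    proof (cases "1 \<le> source_wave m l (Suc t) (k + L)")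
      case True
      then show ?thesis using F_le[of "N + Suc n" k] mass_le e(1)[of "Suc n"] \<epsilon> by (simp add: t_def)
    next
      case False
      let ?\<Phi> = "\<lambda>i. source_wave m l t (i + L)"
      have "(root m (l / real t) * root m (real (nat (k + L + 1)))) ^ Suc m \<le> \<theta> ^ Suc m"
        using slope_behind_front[OF m l(1) t(2,3), of "k + L"] False t(4) by linarith
      then have s1: "root m (l / real t) * root m (real (nat (k + L + 1))) \<le> \<theta>"
        by (rule power_le_imp_le_base) (use \<theta> in simp)
      have s2: "root m (l / real t) * root m (real (nat (k + L))) \<le> \<theta>"
      proof (rule order_trans[OF _ s1])
        show "root m (l / real t) * root m (real (nat (k + L)))
            \<le> root m (l / real t) * root m (real (nat (k + L + 1)))"
          using m l by (intro mult_left_mono) auto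
      qed
      have "F (N + Suc n) k = update (F (N + n) (k - 1)) (F (N + n) k) (F (N + n) (k + 1))"
        using F_step by simp
      also have "\<dots> \<le> update (?\<Phi> (k - 1) + e n) (?\<Phi> k + e n) (?\<Phi> (k + 1) + e n)"
      proof (rule update_mono[OF \<theta>(2) less_imp_le[OF \<theta>(1)]])
        show "F (N + n) (k + 1) - F (N + n) k \<le> \<theta>" using N[of "N + n" "k + 1"] by (simp add: density_def)
        show "F (N + n) k \<le> F (N + n) (k + 1)" using F_mono[of "N + n" "k + 1"] by simp
        have "?\<Phi> k - ?\<Phi> (k - 1) = root m (l / real t) * root m (real (nat (k + L)))"
          using source_wave_diff[of m l t "k + L"] by (simp add: algebra_simps)
        then show "?\<Phi> k + e n - (?\<Phi> (k - 1) + e n) \<le> \<theta>" using s2 by linarith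
      qed (use Suc F_mono l in \<open>auto simp: t_def intro!: source_wave_mono\<close>)
      also have "\<dots> = update (?\<Phi> (k - 1)) (?\<Phi> k) (?\<Phi> (k + 1)) + e n" by (rule hj_step_add_const)
      also have "update (?\<Phi> (k - 1)) (?\<Phi> k) (?\<Phi> (k + 1))
          \<le> source_wave m l (Suc t) (k + L) + C * (root m (l / real t) - root m (l / real (Suc t)))"
        using C(2)[of t "k + L"] t by (simp add: algebra_simps)
      finally show ?thesis unfolding e_def t_def by (simp add: algebra_simps)
    qed
  qed
  then have "F (N + n) k \<le> source_wave m l (T + n) (k + L) + \<epsilon>" for n k
    using e(2)[of n] by (meson add_left_mono order_trans)
  then show ?thesis by blast
qed

end

section \<open>The barrier from below\<close>

context conservative_scheme
begin

text \<open>
  The factor \<open>Suc t\<close> on the left of the assumption comes from bounding the discrete time derivative; the strict inequality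
  between \<open>l * \<sigma> * (m + 1)\<close> and \<open>1\<close> absorbs it at late times.
\<close>

lemma shallow_wave_decay:
  assumes l: "0 < l" and t: "t \<ge> 1" "l * drift * real (Suc m) * real (Suc t) \<le> real t"
  shows "drift * (root m (l / real t) * root m (real (nat k))) ^ Suc m
    \<le> source_wave m l t k - source_wave m l (Suc t) k"
proof -
  define c c' where "c = root m (l / real t)" and "c' = root m (l / real (Suc t))"
  have c0: "0 \<le> c" using l by (simp add: c_def)
  define j where "j = nat k"
  define Y where "Y = real j * root m (real j)"
  have Y0: "0 \<le> Y" by (simp add: Y_def)
  have mpos: "0 < real m" using m by simp
  have "drift * (c * root m (real j)) ^ Suc m = c / real t * (l * drift) * Y"
    unfolding c_def Y_def using slope_power_Suc[OF m, of l t j] l by simp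
  also have "\<dots> \<le> c / real t * (real t / (real (Suc m) * real (Suc t))) * Y"
  proof (intro mult_right_mono mult_left_mono)
    have "l * drift * (real (Suc m) * real (Suc t)) \<le> real t" using t by (simp only: mult.assoc)
    then show "l * drift \<le> real t / (real (Suc m) * real (Suc t))"
      by (subst pos_le_divide_eq) auto
  qed (use c0 Y0 in auto)
  also have "\<dots> = (c / (real m * real (Suc t))) * (real m * (Y / real (Suc m)))"
    using mpos t by simp
  also have "\<dots> \<le> (c / (real m * real (Suc t))) * root_sum m j"
  proof (rule mult_left_mono)
    show "real m * (Y / real (Suc m)) \<le> root_sum m j"
      using root_sum_lower[OF m, of j] by (simp add: Y_def divide_simps mult_ac)
  qed (use c0 in simp)
  also have "\<dots> \<le> (c - c') * root_sum m j"
    unfolding c_def c'_def using root_decay(1)[of m t l] m t l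
    by (intro mult_right_mono root_sum_nonneg) auto
  also have "\<dots> = source_wave m l t k - source_wave m l (Suc t) k"
    unfolding source_wave_def c_def c'_def j_def by (simp add: algebra_simps)
  finally show ?thesis unfolding c_def j_def .
qed

text \<open>
  Let \<open>p\<close> be the slope of the cap at \<open>z1\<close> and \<open>b\<close> the increment of the wave.  Capping turns the decay
  of the wave into \<open>p\<close> times that decay, at least \<open>p * \<sigma> * b ^ (m + 1)\<close>, and the flux into roughly
  \<open>\<sigma> * (p * b) ^ (m + 1)\<close>, which is no larger since \<open>p\<close> is at most \<open>1\<close>.  The slope of
  the cap varies by at most \<open>1 / w\<close> times an increment between neighbouring sites, whence the error
  of order \<open>m + 2\<close> in the increment.
\<close>

lemma capped_step:
  assumes w: "0 < w" and z: "z0 \<le> z1" "z1 \<le> z2" and b: "z1 - z0 \<le> z2 - z1" and z1': "z1' \<le> z1"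
    and decay: "drift * (z1 - z0) ^ Suc m \<le> z1 - z1'"
  shows "soft_min w M z1' \<le> update (soft_min w M z0) (soft_min w M z1) (soft_min w M z2)
    + real (Suc m) / w * (z2 - z1) ^ Suc (Suc m)"
proof -
  let ?h = "soft_min w M"
  define p where "p = soft_slope w M z1"
  define b b' where "b = z1 - z0" and "b' = z2 - z1"
  define x where "x = ?h z1 - ?h z0"
  define z where "z = ?h z2 - ?h z1"
  define E where "E = b' * b' / w"
  define D where "D = real (Suc m) * b' ^ m * E"
  have p: "0 \<le> p" "p \<le> 1" using soft_slope_bounds[OF w] by (auto simp: p_def)
  have bb: "0 \<le> b" "b \<le> b'" "0 \<le> b'" using assms by (auto simp: b_def b'_def)
  have x0: "0 \<le> x" "0 \<le> z"
    using soft_min_mono[OF w z(1)] soft_min_mono[OF w z(2)] by (auto simp: x_def z_def)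
  have "x \<le> soft_slope w M z0 * b"
    using soft_min_tangent[OF w, of M z1 z0] by (simp add: x_def b_def)
  also have "\<dots> \<le> (p + b / w) * b"
    using soft_slope_lipschitz[OF w z(1), of M] bb by (intro mult_right_mono) (auto simp: p_def b_def)
  finally have "x \<le> p * b + b * b / w" by (simp add: algebra_simps)
  moreover have "b * b / w \<le> E" unfolding E_def using bb w by (intro divide_right_mono mult_mono) auto
  ultimately have x1: "x \<le> p * b + E" by linarith
  have xb: "x \<le> b'"
  proof -
    have "x \<le> soft_slope w M z0 * b"
      using soft_min_tangent[OF w, of M z1 z0] by (simp add: x_def b_def)
    also have "\<dots> \<le> 1 * b" using soft_slope_bounds[OF w] bb by (intro mult_right_mono) auto
    finally show ?thesis using bb by simp
  qed
  have "(p - b' / w) * b' \<le> soft_slope w M z2 * b'"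
    using soft_slope_lipschitz[OF w z(2), of M] bb by (intro mult_right_mono) (auto simp: p_def b'_def)
  also have "\<dots> \<le> z"
    using soft_min_tangent[OF w, of M z1 z2] by (simp add: z_def b'_def algebra_simps)
  finally have "p * b' - E \<le> z" by (simp add: E_def algebra_simps)
  moreover have "p * b \<le> p * b'" using p bb by (intro mult_left_mono) auto
  ultimately have z1: "p * b - E \<le> z" by linarith
  have pb: "0 \<le> p * b" "p * b \<le> b'"
    using p bb mult_right_mono[of p 1 b] by auto
  have E0: "0 \<le> E" using bb w by (simp add: E_def)
  have up: "x ^ Suc m - (p * b) ^ Suc m \<le> D"
    unfolding D_def using x0 xb pb x1 E0 by (intro power_Suc_diff_le_gap) auto
  have lo: "(p * b) ^ Suc m - z ^ Suc m \<le> D"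
    unfolding D_def using x0 pb z1 E0 by (intro power_Suc_diff_le_gap) auto
  have D0: "0 \<le> D" using bb E0 by (simp add: D_def)
  have "r * q * x ^ Suc m \<le> r * q * ((p * b) ^ Suc m + D)"
    using up q r by (intro mult_left_mono) auto
  moreover have "(1 - r) * q * ((p * b) ^ Suc m - D) \<le> (1 - r) * q * z ^ Suc m"
    using lo q r by (intro mult_left_mono) auto
  moreover have "r * q * ((p * b) ^ Suc m + D) - (1 - r) * q * ((p * b) ^ Suc m - D)
      = drift * (p * b) ^ Suc m + q * D"
    unfolding drift_def by (simp add: algebra_simps)
  moreover have "q * D \<le> 1 * D" using q D0 by (intro mult_right_mono) auto
  ultimately have flux: "r * q * x ^ Suc m - (1 - r) * q * z ^ Suc m \<le> drift * (p * b) ^ Suc m + D"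
    by linarith
  have "drift * (p * b) ^ Suc m \<le> p * (z1 - z1')"
  proof -
    have "p ^ Suc m \<le> p" using power_decreasing[of 1 "Suc m" p] p by simp
    then have "p ^ Suc m * (drift * b ^ Suc m) \<le> p * (drift * b ^ Suc m)"
      using drift_pos bb by (intro mult_right_mono) auto
    also have "\<dots> \<le> p * (z1 - z1')" using decay p unfolding b_def by (intro mult_left_mono) auto
    finally show ?thesis unfolding power_mult_distrib by (simp only: mult_ac)
  qed
  moreover have "?h z1' \<le> ?h z1 - p * (z1 - z1')"
    using soft_min_tangent[OF w, of M z1' z1] by (simp add: p_def algebra_simps)
  moreover have "update (?h z0) (?h z1) (?h z2) = ?h z1 - (r * q * x ^ Suc m - (1 - r) * q * z ^ Suc m)"
    unfolding hj_step_def x_def z_def by simp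
  moreover have "D = real (Suc m) / w * (z2 - z1) ^ Suc (Suc m)"
    unfolding D_def E_def b'_def [symmetric] by simp
  ultimately show ?thesis using flux by linarith
qed

text \<open>
  By \<open>slope_behind_front\<close> the error in \<open>capped_step\<close> is of order \<open>t powr (- (m + 2) / (m + 1))\<close> where the cap is not flat,
  which is the order of the decrease of \<open>t powr (- 1 / (m + 1))\<close>.
\<close>

lemma capped_wave_subsolution:
  assumes l: "0 < l" "l * drift * real (Suc m) < 1" and w: "0 < w" "w \<le> mass"
  shows "\<exists>C\<ge>0. \<exists>T. \<forall>t\<ge>T. \<forall>k. soft_min w mass (source_wave m l (Suc t) k)
      \<le> update (soft_min w mass (source_wave m l t (k - 1))) (soft_min w mass (source_wave m l t k))
          (soft_min w mass (source_wave m l t (k + 1)))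
        + C * (root (Suc m) (1 / real t) - root (Suc m) (1 / real (Suc t)))"
proof -
  let ?\<Phi> = "source_wave m l"
  let ?h = "soft_min w mass"
  define C1 where "C1 = 4 ^ Suc m * (2 * l) * 2 ^ Suc m"
  define R1 where "R1 = root (Suc m) C1"
  define C where "C = 2 * real (Suc m) * (real (Suc m) / w * C1 * R1)"
  have C1: "0 \<le> C1" "0 \<le> R1" using l by (auto simp: C1_def R1_def)
  have C0: "0 \<le> C" using C1 w by (simp add: C_def)
  have e1: "eventually (\<lambda>t. l / real t \<le> 1) sequentially"
    by (intro eventually_const_over_le) auto
  have e2: "eventually (\<lambda>t. 2 \<le> t) sequentially" by (rule eventually_ge_at_top)
  have e3: "eventually (\<lambda>t. l * drift * real (Suc m) / real t \<le> 1 - l * drift * real (Suc m)) sequentially"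
    using l by (intro eventually_const_over_le) auto
  from e1 e2 e3 have "eventually (\<lambda>t. l / real t \<le> 1 \<and> 2 \<le> t \<and>
      l * drift * real (Suc m) / real t \<le> 1 - l * drift * real (Suc m)) sequentially"
    by eventually_elim simp
  then obtain T where T: "\<And>t. t \<ge> T \<Longrightarrow> l / real t \<le> 1 \<and> 2 \<le> t \<and>
      l * drift * real (Suc m) / real t \<le> 1 - l * drift * real (Suc m)"
    unfolding eventually_sequentially by blast
  have "?h (?\<Phi> (Suc t) k) \<le> update (?h (?\<Phi> t (k - 1))) (?h (?\<Phi> t k)) (?h (?\<Phi> t (k + 1)))
      + C * (root (Suc m) (1 / real t) - root (Suc m) (1 / real (Suc t)))" if t: "t \<ge> T" for t k
  proof -
    let ?c = "root m (l / real t)"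
    define \<omega> where "\<omega> = root (Suc m) (1 / real t)"
    have t2: "2 \<le> t" "l \<le> real t" using T[OF t] by (auto simp: divide_simps split: if_splits)
    have tl: "l * drift * real (Suc m) * real (Suc t) \<le> real t"
    proof -
      have "l * drift * real (Suc m) / real t * real t \<le> (1 - l * drift * real (Suc m)) * real t"
        using T[OF t] by (intro mult_right_mono) auto
      then have "l * drift * real (Suc m) \<le> (1 - l * drift * real (Suc m)) * real t" using t2 by simp
      then show ?thesis by (simp add: algebra_simps)
    qed
    have \<omega>0: "0 \<le> \<omega>" by (simp add: \<omega>_def)
    have gap: "\<omega> / (real (Suc m) * real (Suc t)) \<le> \<omega> - root (Suc m) (1 / real (Suc t))"
      unfolding \<omega>_def using root_decay(1)[of "Suc m" t 1] t2 by simp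
    have gap0: "0 \<le> C * (\<omega> - root (Suc m) (1 / real (Suc t)))"
    proof -
      have "0 \<le> \<omega> / (real (Suc m) * real (Suc t))" using \<omega>0 by simp
      then show ?thesis using gap C0 by (intro mult_nonneg_nonneg) linarith+
    qed
    have mono: "?\<Phi> t (k - 1) \<le> ?\<Phi> t k" "?\<Phi> t k \<le> ?\<Phi> t (k + 1)"
      using l by (auto intro!: source_wave_mono)
    have dec: "?\<Phi> (Suc t) k \<le> ?\<Phi> t k"
      using m l t2 by (intro source_wave_antimono_time) auto
    have hdec: "?h (?\<Phi> (Suc t) k) \<le> ?h (?\<Phi> t k)"
      by (rule soft_min_mono[OF w(1) dec])
    have flat: "?thesis" if "?h (?\<Phi> t (k - 1)) = ?h (?\<Phi> t k)"
    proof -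
      have "?h (?\<Phi> t k) \<le> update (?h (?\<Phi> t (k - 1))) (?h (?\<Phi> t k)) (?h (?\<Phi> t (k + 1)))"
        unfolding hj_step_def that using soft_min_mono[OF w(1) mono(2), of mass] q r by simp
      then show ?thesis using hdec gap0 unfolding \<omega>_def by linarith
    qed
    consider "k \<le> 0" | "mass \<le> ?\<Phi> t (k - 1)" | "0 < k" "?\<Phi> t (k - 1) < mass" by linarith
    then show ?thesis
    proof cases
      case 1
      then show ?thesis by (intro flat) simp
    next
      case 2
      have "?h (?\<Phi> t k) \<le> ?h (?\<Phi> t (k - 1))"
        using soft_min_tangent[OF w(1), of mass "?\<Phi> t k" "?\<Phi> t (k - 1)"] soft_slope_eq_0[OF w(1) 2]
        by simp
      moreover have "?h (?\<Phi> t (k - 1)) \<le> ?h (?\<Phi> t k)" by (rule soft_min_mono[OF w(1) mono(1)])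
      ultimately show ?thesis by (intro flat) simp
    next
      case 3
      define b where "b = ?c * root m (real (nat k))"
      define b' where "b' = ?c * root m (real (nat (k + 1)))"
      have bd: "?\<Phi> t k - ?\<Phi> t (k - 1) = b" unfolding b_def by (rule source_wave_diff)
      have bd': "?\<Phi> t (k + 1) - ?\<Phi> t k = b'"
        unfolding b'_def using source_wave_diff[of m l t "k + 1"] by simp
      have bb: "0 \<le> b" "b \<le> b'" "0 \<le> b'"
        unfolding b_def b'_def using m l by (auto intro!: mult_left_mono)
      have b2: "b' \<le> 2 * b"
      proof -
        define j where "j = nat k"
        have j: "1 \<le> j" "nat (k + 1) = Suc j" using 3 by (auto simp: j_def)
        have "root m (real (Suc j)) \<le> (1 + 1 / real j) * root m (real j)" by (rule root_Suc_le[OF m j(1)])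
        also have "\<dots> \<le> 2 * root m (real j)" using j by (intro mult_right_mono) auto
        finally have "?c * root m (real (Suc j)) \<le> ?c * (2 * root m (real j))"
          using l by (intro mult_left_mono) auto
        then show ?thesis unfolding b_def b'_def j(2) j_def by simp
      qed
      have "?\<Phi> (Suc t) (k - 1) \<le> ?\<Phi> t (k - 1)"
        using m l t2 by (intro source_wave_antimono_time) auto
      then have "?\<Phi> (Suc t) (k - 1) \<le> 1" using 3 mass_le by linarith
      from slope_behind_front[OF m l(1) t2 this]
      have "b ^ Suc m \<le> 4 ^ Suc m * (2 * l) / real t" by (simp add: b_def)
      then have "2 ^ Suc m * b ^ Suc m \<le> 2 ^ Suc m * (4 ^ Suc m * (2 * l) / real t)"
        by (intro mult_left_mono) auto
      moreover have "b' ^ Suc m \<le> (2 * b) ^ Suc m" using b2 bb by (intro power_mono) auto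
      ultimately have b'1: "b' ^ Suc m \<le> C1 / real t"
        unfolding C1_def power_mult_distrib by (simp add: mult_ac)
      have b'2: "b' \<le> R1 * \<omega>"
      proof -
        have "b' = root (Suc m) (b' ^ Suc m)" using bb by (simp only: real_root_power_cancel)
        also have "\<dots> \<le> root (Suc m) (C1 / real t)" using b'1 by (intro real_root_le_mono) auto
        also have "\<dots> = R1 * \<omega>" unfolding R1_def \<omega>_def by (simp add: real_root_mult [symmetric])
        finally show ?thesis .
      qed
      have "?h (?\<Phi> (Suc t) k) \<le> update (?h (?\<Phi> t (k - 1))) (?h (?\<Phi> t k)) (?h (?\<Phi> t (k + 1)))
          + real (Suc m) / w * b' ^ Suc (Suc m)"
      proof -
        have "drift * (?\<Phi> t k - ?\<Phi> t (k - 1)) ^ Suc m \<le> ?\<Phi> t k - ?\<Phi> (Suc t) k"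
          unfolding bd b_def using shallow_wave_decay[OF l(1) _ tl, of k] t2 by simp
        moreover have "?\<Phi> t k - ?\<Phi> t (k - 1) \<le> ?\<Phi> t (k + 1) - ?\<Phi> t k"
          unfolding bd bd' by (rule bb(2))
        ultimately show ?thesis
          using capped_step[OF w(1) mono _ dec, of mass] unfolding bd' by blast
      qed
      moreover have "real (Suc m) / w * b' ^ Suc (Suc m) \<le> C * (\<omega> - root (Suc m) (1 / real (Suc t)))"
      proof -
        have "b' ^ Suc (Suc m) = b' ^ Suc m * b'" by simp
        also have "\<dots> \<le> (C1 / real t) * (R1 * \<omega>)"
          using b'1 b'2 bb C1 by (intro mult_mono) auto
        finally have "real (Suc m) / w * b' ^ Suc (Suc m) \<le> real (Suc m) / w * ((C1 / real t) * (R1 * \<omega>))"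
          using w by (intro mult_left_mono) auto
        also have "\<dots> = C * (\<omega> / (2 * real (Suc m) * real t))"
          unfolding C_def using t2 w by (simp del: of_nat_Suc)
        also have "\<dots> \<le> C * (\<omega> / (real (Suc m) * real (Suc t)))"
        proof (intro mult_left_mono divide_left_mono C0 \<omega>0)
          have "real (Suc m) * real (Suc t) \<le> real (Suc m) * (2 * real t)"
            using t2 by (intro mult_left_mono) auto
          then show "real (Suc m) * real (Suc t) \<le> 2 * real (Suc m) * real t" by (simp only: mult_ac)
        qed (use t2 in auto)
        also have "\<dots> \<le> C * (\<omega> - root (Suc m) (1 / real (Suc t)))"
          using gap C0 by (rule mult_left_mono)
        finally show ?thesis .
      qed
      ultimately show ?thesis unfolding \<omega>_def by linarith
    qed
  qed
  then show ?thesis using C0 by blast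
qed

lemma capped_increment_small:
  assumes l: "0 < l" and w: "0 < w" and \<theta>: "0 < \<theta>"
  shows "\<exists>T. \<forall>t\<ge>T. \<forall>k. soft_min w mass (source_wave m l t (k + 1)) - soft_min w mass (source_wave m l t k) \<le> \<theta>"
proof -
  let ?\<Phi> = "source_wave m l"
  let ?h = "soft_min w mass"
  have e1: "eventually (\<lambda>t. l / real t \<le> 1) sequentially"
    by (intro eventually_const_over_le) auto
  have e2: "eventually (\<lambda>t. 2 \<le> t) sequentially" by (rule eventually_ge_at_top)
  have e3: "eventually (\<lambda>t. 4 ^ Suc m * (2 * l) / real t \<le> \<theta> ^ Suc m) sequentially"
    using \<theta> by (intro eventually_const_over_le) auto
  from e1 e2 e3 have "eventually (\<lambda>t. l / real t \<le> 1 \<and> 2 \<le> t \<and>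
      4 ^ Suc m * (2 * l) / real t \<le> \<theta> ^ Suc m) sequentially"
    by eventually_elim simp
  then obtain T where T: "\<And>t. t \<ge> T \<Longrightarrow> l / real t \<le> 1 \<and> 2 \<le> t \<and>
      4 ^ Suc m * (2 * l) / real t \<le> \<theta> ^ Suc m"
    unfolding eventually_sequentially by blast
  have "?h (?\<Phi> t (k + 1)) - ?h (?\<Phi> t k) \<le> \<theta>" if t: "t \<ge> T" for t k
  proof -
    have t2: "2 \<le> t" "l \<le> real t" using T[OF t] by (auto simp: divide_simps split: if_splits)
    define s where "s = soft_slope w mass (?\<Phi> t k)"
    define b where "b = root m (l / real t) * root m (real (nat (k + 1)))"
    have b0: "0 \<le> b" using l by (simp add: b_def)
    have bd: "?\<Phi> t (k + 1) - ?\<Phi> t k = b"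
      using source_wave_diff[of m l t "k + 1"] by (simp add: b_def)
    have chord: "?h (?\<Phi> t (k + 1)) - ?h (?\<Phi> t k) \<le> s * b"
      using soft_min_tangent[OF w, of mass "?\<Phi> t (k + 1)" "?\<Phi> t k"] unfolding bd s_def by linarith
    show ?thesis
    proof (cases "mass \<le> ?\<Phi> t k")
      case True
      then have "s = 0" unfolding s_def by (rule soft_slope_eq_0[OF w])
      then show ?thesis using chord \<theta> by simp
    next
      case False
      have "?\<Phi> (Suc t) k \<le> ?\<Phi> t k" using m l t2 by (intro source_wave_antimono_time) auto
      then have "?\<Phi> (Suc t) k \<le> 1" using False mass_le by linarith
      from slope_behind_front[OF m l t2 this] have "b ^ Suc m \<le> \<theta> ^ Suc m"
        using T[OF t] unfolding b_def by linarith
      then have "b \<le> \<theta>" by (rule power_le_imp_le_base) (use \<theta> in simp)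
      moreover have "s * b \<le> 1 * b"
        unfolding s_def using soft_slope_bounds[OF w] b0 by (intro mult_right_mono) auto
      ultimately show ?thesis using chord by linarith
    qed
  qed
  then show ?thesis by blast
qed

text \<open>
  The shift to the right by \<open>K\<close> makes the capped wave vanish wherever \<open>F N\<close> has not yet come within \<open>w\<close>
  of its total mass, so it starts below \<open>F N + w\<close>.  Of the total loss \<open>3 * w\<close>, the other two parts are the accumulated
  errors and the rounding of the cap.
\<close>

lemma lower_barrier:
  assumes l: "0 < l" "l * drift * real (Suc m) < 1" and w: "0 < w" "w \<le> mass"
  shows "\<exists>N T L. \<forall>n k. min (source_wave m l (T + n) (k + L)) mass - 3 * w \<le> F (N + n) k"
proof -
  let ?h = "soft_min w mass"
  obtain \<theta> where \<theta>: "0 < \<theta>" "real (Suc m) * \<theta> ^ m \<le> 1" using slope_threshold by blast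
  obtain N where N: "\<And>n k. n \<ge> N \<Longrightarrow> density n k \<le> \<theta>" using density_eventually_small[OF \<theta>(1)] by blast
  obtain C T1 where C: "0 \<le> C" "\<And>t k. t \<ge> T1 \<Longrightarrow> ?h (source_wave m l (Suc t) k)
      \<le> update (?h (source_wave m l t (k - 1))) (?h (source_wave m l t k)) (?h (source_wave m l t (k + 1)))
        + C * (root (Suc m) (1 / real t) - root (Suc m) (1 / real (Suc t)))"
    using capped_wave_subsolution[OF l w] by blast
  obtain T2 where T2: "\<And>t k. t \<ge> T2 \<Longrightarrow>
      ?h (source_wave m l t (k + 1)) - ?h (source_wave m l t k) \<le> \<theta>"
    using capped_increment_small[OF l(1) w(1) \<theta>(1)] by blast
  have "(\<lambda>t. C * root (Suc m) (1 / real t)) \<longlonglongrightarrow> C * 0"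
    by (intro tendsto_intros root_scale_tendsto_0) simp
  then have "eventually (\<lambda>t. C * root (Suc m) (1 / real t) < w) sequentially"
    by (rule order_tendstoD) (use w in simp)
  then obtain T3 where T3: "\<And>t. t \<ge> T3 \<Longrightarrow> C * root (Suc m) (1 / real t) < w"
    unfolding eventually_sequentially by blast
  define T where "T = max (max T1 T2) T3"
  have T: "T \<ge> T1" "T \<ge> T2" "T \<ge> T3" by (auto simp: T_def)
  obtain K where K: "\<And>k. k \<ge> K \<Longrightarrow> mass - w \<le> F N k" using F_right[of w N] w by auto
  define L where "L = - K"
  define e where "e n = C * (root (Suc m) (1 / real T) - root (Suc m) (1 / real (T + n))) + w" for n
  have e2: "e n \<le> 2 * w" for n
  proof -
    have "0 \<le> C * root (Suc m) (1 / real (T + n))" using C by simp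
    moreover have "C * root (Suc m) (1 / real T) < w" using T3 T by blast
    ultimately show ?thesis unfolding e_def right_diff_distrib by linarith
  qed
  have "?h (source_wave m l (T + n) (k + L)) - e n \<le> F (N + n) k" for n k
  proof (induction n arbitrary: k)
    case 0
    have e0: "e 0 = w" by (simp add: e_def)
    show ?case
    proof (cases "k \<le> K")
      case True
      then have "?h (source_wave m l (T + 0) (k + L)) = 0"
        using soft_min_zero[OF w] by (simp add: L_def)
      then show ?thesis using F_nonneg[of N k] e0 w by simp
    next
      case False
      then show ?thesis using K[of k] e0 soft_min_le[OF w(1), of mass "source_wave m l T (k + L)"] by simp
    qed
  next
    case (Suc n)
    define t where "t = T + n"
    have t: "t \<ge> T1" "t \<ge> T2" using T by (auto simp: t_def)
    let ?G = "\<lambda>i. ?h (source_wave m l t (i + L))"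
    have mono: "?G i \<le> ?G j" if "i \<le> j" for i j
      using that l by (intro soft_min_mono[OF w(1)] source_wave_mono) auto
    have "?h (source_wave m l (Suc t) (k + L))
        \<le> update (?G (k - 1)) (?G k) (?G (k + 1))
          + C * (root (Suc m) (1 / real t) - root (Suc m) (1 / real (Suc t)))"
      using C(2)[OF t(1), of "k + L"] by (simp add: algebra_simps)
    moreover have "update (?G (k - 1) + - e n) (?G k + - e n) (?G (k + 1) + - e n)
        = update (?G (k - 1)) (?G k) (?G (k + 1)) + - e n" by (rule hj_step_add_const)
    moreover have "update (?G (k - 1) + - e n) (?G k + - e n) (?G (k + 1) + - e n)
        \<le> update (F (N + n) (k - 1)) (F (N + n) k) (F (N + n) (k + 1))"
    proof (rule update_mono[OF \<theta>(2) less_imp_le[OF \<theta>(1)]])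
      show "F (N + n) k - F (N + n) (k - 1) \<le> \<theta>" using N[of "N + n" k] by (simp add: density_def)
      show "F (N + n) k \<le> F (N + n) (k + 1)" using F_mono[of "N + n" "k + 1"] by simp
      show "?G (k + 1) + - e n - (?G k + - e n) \<le> \<theta>"
        using T2[OF t(2), of "k + L"] by (simp add: algebra_simps)
      show "?G (k - 1) + - e n \<le> F (N + n) (k - 1)" "?G k + - e n \<le> F (N + n) k"
          "?G (k + 1) + - e n \<le> F (N + n) (k + 1)"
        using Suc[of "k - 1"] Suc[of k] Suc[of "k + 1"] unfolding t_def by linarith+
    qed (use F_mono mono in auto)
    ultimately have "?h (source_wave m l (Suc t) (k + L))
        - (C * (root (Suc m) (1 / real t) - root (Suc m) (1 / real (Suc t))) + e n) \<le> F (Suc (N + n)) k"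
      unfolding F_step by linarith
    moreover have "C * (root (Suc m) (1 / real t) - root (Suc m) (1 / real (Suc t))) + e n = e (Suc n)"
      unfolding e_def t_def by (simp add: algebra_simps)
    ultimately show ?case by (simp add: t_def)
  qed
  then have "min (source_wave m l (T + n) (k + L)) mass - 3 * w \<le> F (N + n) k" for n k
    using e2[of n] soft_min_ge[OF w(1), of "source_wave m l (T + n) (k + L)" mass]
    by (smt (verit, best))
  then show ?thesis by blast
qed

end

section \<open>The scaling limit of one residue class\<close>

lemma shifted_ratio_tendsto_1: "(\<lambda>n. real (N + n) / real (T + n)) \<longlonglongrightarrow> 1"
proof -
  have "(\<lambda>n. (real N * (1 / real n) + 1) / (real T * (1 / real n) + 1)) \<longlonglongrightarrow> (real N * 0 + 1) / (real T * 0 + 1)"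
    by (intro tendsto_intros lim_1_over_n) simp
  then have "(\<lambda>n. (real N * (1 / real n) + 1) / (real T * (1 / real n) + 1)) \<longlonglongrightarrow> 1" by simp
  then show ?thesis
  proof (rule Lim_transform_eventually)
    show "\<forall>\<^sub>F n in sequentially. (real N * (1 / real n) + 1) / (real T * (1 / real n) + 1) = real (N + n) / real (T + n)"
      using eventually_gt_at_top[of 0]
    proof eventually_elim
      case (elim n)
      have "real j * (1 / real n) + 1 = real (j + n) / real n" for j
        using elim by (simp add: field_simps)
      then show ?case using elim by simp
    qed
  qed
qed

definition beta_profile :: "nat \<Rightarrow> real \<Rightarrow> real" where
  "beta_profile m x = max 0 x powr (real (Suc m) / real m)"

lemma beta_profile_nonneg: "0 \<le> beta_profile m x"
  by (simp add: beta_profile_def)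

lemma beta_profile_mult:
  assumes "0 \<le> c"
  shows "beta_profile m (c * x) = c powr (real (Suc m) / real m) * beta_profile m x"
proof -
  have "max 0 (c * x) = c * max 0 x" using assms by (simp add: max_mult_distrib_left)
  then show ?thesis using assms by (simp add: beta_profile_def powr_mult)
qed

lemma tendsto_beta_profile:
  assumes "m \<ge> 1" "(f \<longlongrightarrow> y) sequentially"
  shows "((\<lambda>n. beta_profile m (f n)) \<longlongrightarrow> beta_profile m y) sequentially"
  unfolding beta_profile_def using assms
  by (intro tendsto_powr' tendsto_max tendsto_const) auto

lemma nat_times_root:
  assumes "m \<ge> 1"
  shows "real j * root m (real j) = beta_profile m (real j)"
proof (cases "j = 0")
  case False
  have "real j * root m (real j) = real j powr 1 * real j powr (1 / real m)"
    using assms False by (simp add: root_powr_inverse)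
  also have "\<dots> = real j powr (1 + 1 / real m)" by (rule powr_add [symmetric])
  also have "1 + 1 / real m = real (Suc m) / real m" using assms by (simp add: field_simps)
  finally show ?thesis by (simp add: beta_profile_def)
qed (simp add: beta_profile_def)

lemma root_sum_between:
  assumes "m \<ge> 1"
  shows "real m / real (Suc m) * beta_profile m (real_of_int k) \<le> root_sum m (nat k)"
    and "root_sum m (nat k) \<le> real m / real (Suc m) * beta_profile m (real_of_int (k + 1))"
proof -
  show "real m / real (Suc m) * beta_profile m (real_of_int k) \<le> root_sum m (nat k)"
  proof (cases "k \<le> 0")
    case True
    then show ?thesis by (simp add: beta_profile_def)
  next
    case False
    then have "real m * beta_profile m (real_of_int k) \<le> real (Suc m) * root_sum m (nat k)"
      using root_sum_lower[OF assms, of "nat k"] unfolding nat_times_root[OF assms] by simp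
    then show ?thesis by (simp add: divide_simps mult_ac)
  qed
  show "root_sum m (nat k) \<le> real m / real (Suc m) * beta_profile m (real_of_int (k + 1))"
  proof (cases "k < 0")
    case True
    then show ?thesis using beta_profile_nonneg by simp
  next
    case False
    then have "real (Suc (nat k)) = real_of_int (k + 1)" by simp
    then have "real (Suc m) * root_sum m (nat k) \<le> real m * beta_profile m (real_of_int (k + 1))"
      using root_sum_upper[OF assms, of "nat k"] unfolding nat_times_root[OF assms] by (simp add: add.commute)
    then show ?thesis by (simp add: divide_simps mult_ac)
  qed
qed

lemma source_wave_between:
  assumes m: "m \<ge> 1" and l: "0 < l" and t: "t \<ge> (1::nat)"
  defines "\<mu> \<equiv> (l / real t) powr (1 / real (Suc m))"
  shows "real m / real (Suc m) * beta_profile m (\<mu> * real_of_int k) \<le> source_wave m l t k"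
    and "source_wave m l t k \<le> real m / real (Suc m) * beta_profile m (\<mu> * real_of_int (k + 1))"
proof -
  have "\<mu> powr (real (Suc m) / real m) = (l / real t) powr (1 / real (Suc m) * (real (Suc m) / real m))"
    unfolding \<mu>_def powr_powr ..
  also have "1 / real (Suc m) * (real (Suc m) / real m) = 1 / real m" by simp
  also have "(l / real t) powr (1 / real m) = root m (l / real t)"
    using m l t by (simp add: root_powr_inverse)
  finally have \<mu>: "\<mu> powr (real (Suc m) / real m) = root m (l / real t)" .
  have \<mu>0: "0 \<le> \<mu>" by (simp add: \<mu>_def)
  have c0: "0 \<le> root m (l / real t)" using l by simp
  show "real m / real (Suc m) * beta_profile m (\<mu> * real_of_int k) \<le> source_wave m l t k"
    unfolding beta_profile_mult[OF \<mu>0] \<mu> source_wave_def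
    using mult_left_mono[OF root_sum_between(1)[OF m, of k] c0] by (simp only: mult_ac)
  show "source_wave m l t k \<le> real m / real (Suc m) * beta_profile m (\<mu> * real_of_int (k + 1))"
    unfolding beta_profile_mult[OF \<mu>0] \<mu> source_wave_def
    using mult_left_mono[OF root_sum_between(2)[OF m, of k] c0] by (simp only: mult_ac)
qed

definition spatial_scale :: "nat \<Rightarrow> real \<Rightarrow> nat \<Rightarrow> real" where
  "spatial_scale m \<sigma> n = 1 / (real m + 1) * (real m ^ m / (\<sigma> * real n)) powr (1 / (real m + 1))"

text \<open>
  The parameter \<open>l\<close> is normalised such that \<open>s = 1\<close> is the exact solution.  The limit does not see the time shifts
  \<open>N\<close> and \<open>T\<close> or the spatial shift \<open>L\<close>.
\<close>

lemma source_wave_scaling_limit: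
  assumes m: "m \<ge> 1" and \<sigma>: "0 < \<sigma>" and s: "0 < s"
    and K: "(\<lambda>n. spatial_scale m \<sigma> n * real_of_int (K n)) \<longlonglongrightarrow> y"
  defines "l \<equiv> s ^ m / (\<sigma> * real (Suc m))"
  shows "(\<lambda>n. source_wave m l (T + n) (K (N + n) + L)) \<longlonglongrightarrow> s * beta_profile m y"
proof -
  have l: "0 < l" using s \<sigma> by (simp add: l_def)
  have M: "real (Suc m) = real m + 1" by simp
  define e where "e = 1 / real (Suc m)"
  define \<mu> where "\<mu> n = (l / real (T + n)) powr e" for n
  define \<rho> where "\<rho> = real (Suc m) * (l * \<sigma> / real m ^ m) powr e"
  have \<rho>0: "0 \<le> \<rho>" by (simp add: \<rho>_def)
  have ratio: "(\<lambda>n. real (Suc m) * ((l * \<sigma> / real m ^ m) * (real (N + n) / real (T + n))) powr e) \<longlonglongrightarrow> \<rho>"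
  proof -
    have "(\<lambda>n. real (Suc m) * ((l * \<sigma> / real m ^ m) * (real (N + n) / real (T + n))) powr e)
        \<longlonglongrightarrow> real (Suc m) * ((l * \<sigma> / real m ^ m) * 1) powr e"
      using l \<sigma> m by (intro tendsto_intros shifted_ratio_tendsto_1) auto
    then show ?thesis by (simp add: \<rho>_def)
  qed
  have KN: "(\<lambda>n. spatial_scale m \<sigma> (N + n) * real_of_int (K (N + n))) \<longlonglongrightarrow> y"
    using LIMSEQ_ignore_initial_segment[OF K, of N] by (simp add: add.commute)
  have main: "(\<lambda>n. \<mu> n * real_of_int (K (N + n))) \<longlonglongrightarrow> \<rho> * y"
  proof (rule Lim_transform_eventually[OF tendsto_mult[OF ratio KN]])
    show "\<forall>\<^sub>F n in sequentially.
        real (Suc m) * ((l * \<sigma> / real m ^ m) * (real (N + n) / real (T + n))) powr e *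
        (spatial_scale m \<sigma> (N + n) * real_of_int (K (N + n))) = \<mu> n * real_of_int (K (N + n))"
      using eventually_gt_at_top[of 0]
    proof eventually_elim
      case (elim n)
      have "real (Suc m) * ((l * \<sigma> / real m ^ m) * (real (N + n) / real (T + n))) powr e * spatial_scale m \<sigma> (N + n)
        = ((l * \<sigma> / real m ^ m) * (real (N + n) / real (T + n))) powr e
          * (real m ^ m / (\<sigma> * real (N + n))) powr e"
        unfolding spatial_scale_def e_def M by simp
      also have "\<dots> = ((l * \<sigma> / real m ^ m) * (real (N + n) / real (T + n))
          * (real m ^ m / (\<sigma> * real (N + n)))) powr e"
        using l \<sigma> by (intro powr_mult [symmetric])
      also have "(l * \<sigma> / real m ^ m) * (real (N + n) / real (T + n))
          * (real m ^ m / (\<sigma> * real (N + n))) = l / real (T + n)"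
        using \<sigma> m elim by (simp add: field_simps del: of_nat_add)
      finally show ?case unfolding \<mu>_def by (simp only: mult.assoc [symmetric])
    qed
  qed
  have \<mu>0: "\<mu> \<longlonglongrightarrow> 0"
  proof -
    have "(\<lambda>n. l * (1 / real (n + T))) \<longlonglongrightarrow> l * 0"
      by (intro tendsto_intros LIMSEQ_ignore_initial_segment[OF lim_1_over_n])
    then have "(\<lambda>n. (l * (1 / real (n + T))) powr e) \<longlonglongrightarrow> (l * 0) powr e"
      using l by (intro tendsto_powr' tendsto_const) (auto simp: e_def)
    then show ?thesis unfolding \<mu>_def by (simp add: add.commute)
  qed
  have shift: "(\<lambda>n. real m / real (Suc m) * beta_profile m (\<mu> n * real_of_int (K (N + n) + c)))
      \<longlonglongrightarrow> s * beta_profile m y" for c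
  proof -
    have "(\<lambda>n. \<mu> n * real_of_int (K (N + n)) + \<mu> n * real_of_int c) \<longlonglongrightarrow> \<rho> * y + 0 * real_of_int c"
      by (intro tendsto_intros main \<mu>0)
    then have "(\<lambda>n. \<mu> n * real_of_int (K (N + n) + c)) \<longlonglongrightarrow> \<rho> * y"
      by (simp add: algebra_simps)
    then have "(\<lambda>n. real m / real (Suc m) * beta_profile m (\<mu> n * real_of_int (K (N + n) + c)))
        \<longlonglongrightarrow> real m / real (Suc m) * beta_profile m (\<rho> * y)"
      by (rule tendsto_mult[OF tendsto_const tendsto_beta_profile[OF m]])
    moreover have "real m / real (Suc m) * beta_profile m (\<rho> * y) = s * beta_profile m y"
    proof -
      have mp: "0 < real m" using m by simp
      have "l * \<sigma> / real m ^ m = (s / real m) ^ m / real (Suc m)"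
        using \<sigma> by (simp add: l_def power_divide)
      then have "\<rho> powr (real (Suc m) / real m)
          = real (Suc m) powr (real (Suc m) / real m)
            * ((s / real m) ^ m / real (Suc m)) powr (e * (real (Suc m) / real m))"
        unfolding \<rho>_def by (simp add: powr_mult powr_powr del: of_nat_Suc)
      also have "e * (real (Suc m) / real m) = 1 / real m" by (simp add: e_def)
      also have "((s / real m) ^ m / real (Suc m)) powr (1 / real m)
          = (s / real m) / real (Suc m) powr (1 / real m)"
      proof -
        have "((s / real m) ^ m) powr (1 / real m) = s / real m"
          using s mp by (simp add: powr_realpow [symmetric] powr_powr)
        then show ?thesis using s mp by (simp add: powr_divide)
      qed
      also have "real (Suc m) powr (real (Suc m) / real m)
          = real (Suc m) * real (Suc m) powr (1 / real m)"
      proof -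
        have "real (Suc m) / real m = 1 + 1 / real m" using mp by (simp add: field_simps)
        then show ?thesis by (simp add: powr_add)
      qed
      also have "real (Suc m) * real (Suc m) powr (1 / real m) * (s / real m / real (Suc m) powr (1 / real m))
          = real (Suc m) * s / real m" by simp
      finally have "\<rho> powr (real (Suc m) / real m) = real (Suc m) * s / real m" .
      then show ?thesis unfolding beta_profile_mult[OF \<rho>0] using mp by simp
    qed
    ultimately show ?thesis by simp
  qed
  show ?thesis
  proof (rule tendsto_sandwich[OF _ _ shift[of L] shift[of "L + 1"]])
    show "\<forall>\<^sub>F n in sequentially. real m / real (Suc m) * beta_profile m (\<mu> n * real_of_int (K (N + n) + L))
        \<le> source_wave m l (T + n) (K (N + n) + L)"
      using eventually_gt_at_top[of 0]
    proof eventually_elim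
      case (elim n)
      then show ?case unfolding \<mu>_def e_def by (intro source_wave_between m l) simp
    qed
    show "\<forall>\<^sub>F n in sequentially. source_wave m l (T + n) (K (N + n) + L)
        \<le> real m / real (Suc m) * beta_profile m (\<mu> n * real_of_int (K (N + n) + (L + 1)))"
      using eventually_gt_at_top[of 0]
    proof eventually_elim
      case (elim n)
      then show ?case unfolding \<mu>_def e_def add.assoc [symmetric] by (intro source_wave_between m l) simp
    qed
  qed
qed

text \<open>
  For a target above the limit use the upper barrier with \<open>s\<close> slightly above \<open>1\<close>, for a target below the limit the lower
  barrier with \<open>s\<close> slightly below \<open>1\<close>.
\<close>

lemma (in conservative_scheme) scaling_limit:
  assumes K: "(\<lambda>n. spatial_scale m drift n * real_of_int (K n)) \<longlonglongrightarrow> y"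
  shows "(\<lambda>n. F n (K n)) \<longlonglongrightarrow> min mass (beta_profile m y)"
proof -
  define v where "v = beta_profile m y"
  have v0: "0 \<le> v" by (simp add: v_def beta_profile_nonneg)
  have speed: "s ^ m / (drift * real (Suc m)) * drift * real (Suc m) = s ^ m" for s
    using drift_pos by simp
  have lpos: "0 < s ^ m / (drift * real (Suc m))" if "0 < s" for s
    using that drift_pos by simp
  have wave: "(\<lambda>n. source_wave m (s ^ m / (drift * real (Suc m))) (T + n) (K (N + n) + L)) \<longlonglongrightarrow> s * v"
    if "0 < s" for s T N L
    unfolding v_def by (rule source_wave_scaling_limit[OF m drift_pos that K])
  have shift: "eventually P sequentially" if "eventually (\<lambda>n. P (N + n)) sequentially" for P and N :: nat
    using that eventually_sequentially_seg[of P N] by (simp add: add.commute)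
  have "(\<lambda>n. F n (K n)) \<longlonglongrightarrow> min mass v"
  proof (rule order_tendstoI)
    fix u assume u: "min mass v < u"
    show "\<forall>\<^sub>F n in sequentially. F n (K n) < u"
    proof (cases "mass < u")
      case True
      then show ?thesis using F_le by (intro always_eventually allI) (meson le_less_trans)
    next
      case False
      then have uv: "v < u" using u by simp
      \<comment> \<open>The denominator \<open>v + 1\<close> covers \<open>v = 0\<close>; the product \<open>s * v\<close> is at most the midpoint of \<open>u\<close> and \<open>v\<close>.\<close>
      define s where "s = 1 + (u - v) / (2 * (v + 1))"
      have s1: "1 < s" using uv v0 by (simp add: s_def)
      have "s * v = v + (u - v) / 2 * (v / (v + 1))" using v0 by (simp add: s_def field_simps)
      also have "\<dots> \<le> v + (u - v) / 2 * 1" using uv v0 by (intro add_left_mono mult_left_mono) auto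
      finally have sv: "s * v \<le> (u + v) / 2" by (simp add: field_simps)
      let ?l = "s ^ m / (drift * real (Suc m))"
      have "1 < s ^ m" using s1 m by (intro one_less_power) auto
      then obtain N T L where bar: "\<And>n k. F (N + n) k \<le> source_wave m ?l (T + n) (k + L) + (u - v) / 4"
        using upper_barrier[of ?l "(u - v) / 4"] lpos[of s] speed[of s] s1 uv by auto
      have "\<forall>\<^sub>F n in sequentially. source_wave m ?l (T + n) (K (N + n) + L) < u - (u - v) / 4"
        by (rule order_tendstoD(2)[OF wave]) (use s1 sv uv in \<open>auto simp: field_simps\<close>)
      then have "\<forall>\<^sub>F n in sequentially. F (N + n) (K (N + n)) < u"
      proof eventually_elim
        case (elim n)
        then show ?case using bar[of n "K (N + n)"] by linarith
      qed
      then show ?thesis by (rule shift)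
    qed
  next
    fix u assume u: "u < min mass v"
    show "\<forall>\<^sub>F n in sequentially. u < F n (K n)"
    proof (cases "u < 0")
      case True
      then show ?thesis using F_nonneg by (intro always_eventually allI) (meson less_le_trans)
    next
      case False
      then have uv: "0 \<le> u" "u < v" "u < mass" using u by auto
      define s where "s = (u + v) / (2 * v)"
      have s0: "0 < s" "s < 1" using uv by (auto simp: s_def field_simps)
      have sv: "s * v = (u + v) / 2" using uv by (simp add: s_def)
      let ?l = "s ^ m / (drift * real (Suc m))"
      have sm: "s ^ m < 1" using power_strict_decreasing[of 0 m s] s0 m by simp
      define w where "w = (min mass (s * v) - u) / 6"
      have w: "0 < w" "w \<le> mass" "u + 3 * w < s * v" "u + 3 * w < mass"
        using uv sv by (auto simp: w_def min_def field_simps)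
      obtain N T L where bar: "\<And>n k. min (source_wave m ?l (T + n) (k + L)) mass - 3 * w \<le> F (N + n) k"
        using lower_barrier[of ?l w] lpos[OF s0(1)] speed[of s] sm w by auto
      have "\<forall>\<^sub>F n in sequentially. u + 3 * w < source_wave m ?l (T + n) (K (N + n) + L)"
        by (rule order_tendstoD(1)[OF wave[OF s0(1)] w(3)])
      then have "\<forall>\<^sub>F n in sequentially. u < F (N + n) (K (N + n))"
      proof eventually_elim
        case (elim n)
        then show ?case using bar[of n "K (N + n)"] w(4) by linarith
      qed
      then show ?thesis by (rule shift)
    qed
  qed
  then show ?thesis unfolding v_def .
qed

section \<open>The motion on one residue class\<close>

locale lazy_cooperative_motion = generalized_cooperative_motion +
  fixes q r :: real and R :: nat
  assumes m_pos: "m \<ge> 1" and q_range: "0 < q" "q \<le> 1" and r_range: "1 / 2 < r" "r \<le> 1"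
    and not_deterministic: "\<not> (r = 1 \<and> q = 1)" and R_pos: "R > 0"
    and step_right: "\<And>n. prob {\<omega> \<in> space M. D n \<omega> = int R} = r * q"
    and step_zero: "\<And>n. prob {\<omega> \<in> space M. D n \<omega> = 0} = 1 - q"
    and step_left: "\<And>n. prob {\<omega> \<in> space M. D n \<omega> = - int R} = (1 - r) * q"
begin

lemma joint_measurable:
  "i \<in> {0..m + 1} \<Longrightarrow>
    (if i = 0 then X n else if i \<le> m then Xc n i else D n) \<in> measurable M (count_space UNIV)"
  using indep_copies_step[of n] unfolding indep_vars_def by blast

lemma position_measurable: "X n \<in> measurable M (count_space UNIV)"
  using joint_measurable[of 0 n] by simp

lemma copy_measurable: "i \<in> {1..m} \<Longrightarrow> Xc n i \<in> measurable M (count_space UNIV)"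
  using joint_measurable[of i n] by simp

lemma step_measurable: "D n \<in> measurable M (count_space UNIV)"
  using joint_measurable[of "m + 1" n] by simp

lemma position_event: "{\<omega> \<in> space M. P (X n \<omega>)} \<in> events"
proof -
  have "X n -` {x. P x} \<inter> space M \<in> events" by (rule measurable_sets[OF position_measurable]) simp
  then show ?thesis by (simp add: vimage_def Int_def conj_commute)
qed

lemma step_event: "{\<omega> \<in> space M. P (D n \<omega>)} \<in> events"
proof -
  have "D n -` {x. P x} \<inter> space M \<in> events" by (rule measurable_sets[OF step_measurable]) simp
  then show ?thesis by (simp add: vimage_def Int_def conj_commute)
qed

lemma AE_step_values: "AE \<omega> in M. D n \<omega> \<in> {int R, 0, - int R}"
proof -
  let ?E = "\<lambda>d. {\<omega> \<in> space M. D n \<omega> = d}"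
  have R: "int R \<noteq> 0" "int R \<noteq> - int R" using R_pos by auto
  have "prob (?E (int R) \<union> ?E 0 \<union> ?E (- int R)) = prob (?E (int R)) + prob (?E 0) + prob (?E (- int R))"
    using R step_event by (subst finite_measure_Union; (subst finite_measure_Union)?) auto
  also have "\<dots> = 1" unfolding step_right step_zero step_left by (simp add: algebra_simps)
  finally have "prob (?E (int R) \<union> ?E 0 \<union> ?E (- int R)) = 1" .
  then have "AE \<omega> in M. \<omega> \<in> ?E (int R) \<union> ?E 0 \<union> ?E (- int R)"
    using step_event by (subst (asm) prob_eq_1) auto
  then show ?thesis by eventually_elim auto
qed

definition meeting :: "nat \<Rightarrow> int \<Rightarrow> int \<Rightarrow> 'a set" where
  "meeting n x d = {\<omega> \<in> space M. X n \<omega> = x \<and> (\<forall>i\<in>{1..m}. Xc n i \<omega> = x) \<and> D n \<omega> = d}"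

lemma meeting_eq_Int:
  "meeting n x d = (\<Inter>i\<in>{0..m + 1}. (if i = 0 then X n else if i \<le> m then Xc n i else D n)
      -` (if i \<le> m then {x} else {d}) \<inter> space M)"
proof -
  have "{0..m + 1} = insert 0 (insert (Suc m) {1..m})" by auto
  then show ?thesis unfolding meeting_def by auto
qed

lemma meeting_event: "meeting n x d \<in> events"
  unfolding meeting_eq_Int
proof (rule sets.finite_INT)
  fix i assume "i \<in> {0..m + 1}"
  from measurable_sets[OF joint_measurable[OF this]]
  show "(if i = 0 then X n else if i \<le> m then Xc n i else D n) -` (if i \<le> m then {x} else {d}) \<inter> space M \<in> events"
    by simp
qed auto

lemma copy_prob:
  assumes "i \<in> {1..m}"
  shows "prob (Xc n i -` {x} \<inter> space M) = prob {\<omega> \<in> space M. X n \<omega> = x}"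
proof -
  have "measure (distr M (count_space UNIV) (Xc n i)) {x} = measure (distr M (count_space UNIV) (X n)) {x}"
    using copies_law[OF assms] by simp
  then have "prob (Xc n i -` {x} \<inter> space M) = prob (X n -` {x} \<inter> space M)"
    using position_measurable copy_measurable[OF assms] by (simp add: measure_distr)
  also have "X n -` {x} \<inter> space M = {\<omega> \<in> space M. X n \<omega> = x}" by auto
  finally show ?thesis .
qed

lemma prob_meeting:
  "prob (meeting n x d) = prob {\<omega> \<in> space M. X n \<omega> = x} ^ Suc m * prob {\<omega> \<in> space M. D n \<omega> = d}"
proof -
  let ?V = "\<lambda>i. if i = 0 then X n else if i \<le> m then Xc n i else D n"
  let ?A = "\<lambda>i. if i \<le> m then {x} else {d}"
  have "prob (meeting n x d) = (\<Prod>i\<in>{0..m + 1}. prob (?V i -` ?A i \<inter> space M))"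
    unfolding meeting_eq_Int by (rule indep_varsD[OF indep_copies_step]) auto
  also have "\<dots> = (\<Prod>i\<in>{0..m}. prob (?V i -` ?A i \<inter> space M)) * prob (?V (Suc m) -` ?A (Suc m) \<inter> space M)"
    by simp
  also have "(\<Prod>i\<in>{0..m}. prob (?V i -` ?A i \<inter> space M)) = (\<Prod>i\<in>{0..m}. prob {\<omega> \<in> space M. X n \<omega> = x})"
  proof (rule prod.cong)
    fix i assume i: "i \<in> {0..m}"
    show "prob (?V i -` ?A i \<inter> space M) = prob {\<omega> \<in> space M. X n \<omega> = x}"
    proof (cases "i = 0")
      case True
      then show ?thesis by (auto intro!: arg_cong[where f = prob])
    next
      case False
      then show ?thesis using i copy_prob[of i n x] by simp
    qed
  qed simp
  also have "\<dots> = prob {\<omega> \<in> space M. X n \<omega> = x} ^ Suc m" by simp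
  also have "?V (Suc m) -` ?A (Suc m) \<inter> space M = {\<omega> \<in> space M. D n \<omega> = d}" by auto
  finally show ?thesis .
qed

definition site :: "nat \<Rightarrow> int \<Rightarrow> int" where
  "site j k = int R * k + int j"

lemma site_inject: "site j k = site j k' \<longleftrightarrow> k = k'"
  using R_pos by (simp add: site_def)

lemma site_shift: "site j k + int R = site j (k + 1)" "site j k - int R = site j (k - 1)"
  by (simp_all add: site_def algebra_simps)

definition class_cdf :: "nat \<Rightarrow> nat \<Rightarrow> int \<Rightarrow> real" where
  "class_cdf j n k = prob {\<omega> \<in> space M. \<exists>i\<le>k. X n \<omega> = site j i}"

definition class_mass :: "nat \<Rightarrow> real" where
  "class_mass j = prob {\<omega> \<in> space M. \<exists>i. X 0 \<omega> = site j i}"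

lemma class_cdf_diff: "class_cdf j n k - class_cdf j n (k - 1) = prob {\<omega> \<in> space M. X n \<omega> = site j k}"
proof -
  have "{\<omega> \<in> space M. \<exists>i\<le>k. X n \<omega> = site j i}
      = {\<omega> \<in> space M. \<exists>i\<le>k - 1. X n \<omega> = site j i} \<union> {\<omega> \<in> space M. X n \<omega> = site j k}"
    by (auto; metis zle_diff1_eq le_less)
  then have "class_cdf j n k = class_cdf j n (k - 1) + prob {\<omega> \<in> space M. X n \<omega> = site j k}"
    unfolding class_cdf_def
    by (simp only:) (intro finite_measure_Union position_event, auto simp: site_inject)
  then show ?thesis by simp
qed

lemma AE_next_position:
  "AE \<omega> in M. \<omega> \<in> space M \<and>
    (X (Suc n) \<omega> = X n \<omega> \<and> \<omega> \<notin> meeting n (X n \<omega>) (int R) \<and> \<omega> \<notin> meeting n (X n \<omega>) (- int R)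
    \<or> X (Suc n) \<omega> = X n \<omega> + int R \<and> \<omega> \<in> meeting n (X n \<omega>) (int R)
    \<or> X (Suc n) \<omega> = X n \<omega> - int R \<and> \<omega> \<in> meeting n (X n \<omega>) (- int R))"
  using AE_step_values[of n] AE_space
proof eventually_elim
  case (elim \<omega>)
  then show ?case using motion_step[of \<omega> n] R_pos unfolding meeting_def
    by (auto split: if_splits)
qed

lemma class_mass_eq: "prob {\<omega> \<in> space M. \<exists>i. X n \<omega> = site j i} = class_mass j"
proof (induction n)
  case (Suc n)
  have "prob {\<omega> \<in> space M. \<exists>i. X (Suc n) \<omega> = site j i} = prob {\<omega> \<in> space M. \<exists>i. X n \<omega> = site j i}"
  proof (rule finite_measure_eq_AE[OF _ position_event position_event])
    show "AE \<omega> in M. \<omega> \<in> {\<omega> \<in> space M. \<exists>i. X (Suc n) \<omega> = site j i}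
        \<longleftrightarrow> \<omega> \<in> {\<omega> \<in> space M. \<exists>i. X n \<omega> = site j i}"
      using AE_next_position[of n]
    proof eventually_elim
      case (elim \<omega>)
      have a: "x + int R = site j i \<longleftrightarrow> x = site j (i - 1)" "x - int R = site j i \<longleftrightarrow> x = site j (i + 1)" for x i
        using site_shift[of j i] by auto
      have b: "(\<exists>i. x = site j (i - 1)) \<longleftrightarrow> (\<exists>i. x = site j i)" "(\<exists>i. x = site j (i + 1)) \<longleftrightarrow> (\<exists>i. x = site j i)" for x
        by (metis add_diff_cancel_right' diff_add_cancel)+
      from elim consider "X (Suc n) \<omega> = X n \<omega>" | "X (Suc n) \<omega> = X n \<omega> + int R"
        | "X (Suc n) \<omega> = X n \<omega> - int R" by blast
      then have "(\<exists>i. X (Suc n) \<omega> = site j i) \<longleftrightarrow> (\<exists>i. X n \<omega> = site j i)"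
        by cases (simp_all only: a b)
      then show ?case by blast
    qed
  qed
  then show ?case using Suc by simp
qed (simp add: class_mass_def)

text \<open>
  Up to null sets, the half line of class \<open>j\<close> ending at site \<open>k\<close> is left exactly by meetings at site \<open>k\<close> that
  draw the step \<open>R\<close>, and entered exactly by meetings at site \<open>k + 1\<close> that draw \<open>- R\<close>.
  Independence of the position, its copies and the step evaluates both probabilities.
\<close>

lemma class_cdf_step:
  "class_cdf j (Suc n) k = hj_step m (r * q) ((1 - r) * q) (class_cdf j n (k - 1)) (class_cdf j n k) (class_cdf j n (k + 1))"
proof -
  let ?S = "\<lambda>n. {\<omega> \<in> space M. \<exists>i\<le>k. X n \<omega> = site j i}"
  let ?P = "meeting n (site j k) (int R)" and ?Q = "meeting n (site j (k + 1)) (- int R)"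
  have a: "x + int R = site j i \<longleftrightarrow> x = site j (i - 1)" "x - int R = site j i \<longleftrightarrow> x = site j (i + 1)" for x i
    using site_shift[of j i] by auto
  have R: "int R \<noteq> - int R" using R_pos by simp
  have pos: "\<omega> \<in> meeting n x d \<Longrightarrow> X n \<omega> = x \<and> D n \<omega> = d" for \<omega> x d by (simp add: meeting_def)
  have "AE \<omega> in M. \<omega> \<in> ?S (Suc n) - ?P \<longleftrightarrow> \<omega> \<in> (?S n - ?P) \<union> (?Q - ?P)"
    using AE_next_position[of n]
  proof eventually_elim
    case (elim \<omega>)
    then consider
        "X (Suc n) \<omega> = X n \<omega>" "\<omega> \<notin> meeting n (X n \<omega>) (int R)" "\<omega> \<notin> meeting n (X n \<omega>) (- int R)"
      | "X (Suc n) \<omega> = X n \<omega> + int R" "\<omega> \<in> meeting n (X n \<omega>) (int R)"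
      | "X (Suc n) \<omega> = X n \<omega> - int R" "\<omega> \<in> meeting n (X n \<omega>) (- int R)" by blast
    then show ?case
    proof cases
      case 1
      then have "\<omega> \<notin> ?P" "\<omega> \<notin> ?Q" using pos by metis+
      then show ?thesis using 1 by auto
    next
      case 2
      then have d: "D n \<omega> = int R" using pos by blast
      then have q: "\<omega> \<notin> ?Q" using pos R by metis
      have p: "\<omega> \<in> ?P \<longleftrightarrow> X n \<omega> = site j k" using 2(2) pos by metis
      have "(\<exists>i\<le>k. X (Suc n) \<omega> = site j i) \<longleftrightarrow> (\<exists>i\<le>k - 1. X n \<omega> = site j i)"
        unfolding 2 a by (metis add_diff_cancel_right' diff_add_cancel diff_right_mono add_right_mono)
      moreover have "(\<exists>i\<le>k. X n \<omega> = site j i) \<and> X n \<omega> \<noteq> site j k \<longleftrightarrow> (\<exists>i\<le>k - 1. X n \<omega> = site j i)"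
        by (auto simp: site_inject; metis zle_diff1_eq le_less)
      ultimately show ?thesis using q p elim by blast
    next
      case 3
      then have d: "D n \<omega> = - int R" using pos by blast
      then have p: "\<omega> \<notin> ?P" using pos R by metis
      have q: "\<omega> \<in> ?Q \<longleftrightarrow> X n \<omega> = site j (k + 1)" using 3(2) pos by metis
      have "(\<exists>i\<le>k. X (Suc n) \<omega> = site j i) \<longleftrightarrow> (\<exists>i\<le>k + 1. X n \<omega> = site j i)"
        unfolding 3 a by (metis add_diff_cancel_right' diff_add_cancel diff_right_mono add_right_mono)
      moreover have "(\<exists>i\<le>k. X n \<omega> = site j i) \<or> X n \<omega> = site j (k + 1) \<longleftrightarrow> (\<exists>i\<le>k + 1. X n \<omega> = site j i)"
        by (auto; metis zle_add1_eq_le le_less)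
      ultimately show ?thesis using q p elim by blast
    qed
  qed
  then have e: "prob (?S (Suc n) - ?P) = prob ((?S n - ?P) \<union> (?Q - ?P))"
    by (rule finite_measure_eq_AE) (intro sets.Diff sets.Un position_event meeting_event)+
  have disj: "AE \<omega> in M. \<omega> \<in> ?S (Suc n) - ?P \<longleftrightarrow> \<omega> \<in> ?S (Suc n)"
    using AE_next_position[of n]
  proof eventually_elim
    case (elim \<omega>)
    show ?case
    proof (cases "\<omega> \<in> ?P")
      case True
      then have "X n \<omega> = site j k" "D n \<omega> = int R" using pos by blast+
      then have "X (Suc n) \<omega> = X n \<omega> + int R" using elim True pos R by metis
      then have "X (Suc n) \<omega> = site j (k + 1)" using \<open>X n \<omega> = site j k\<close> site_shift by simp
      then show ?thesis using True by (auto simp: site_inject)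
    qed auto
  qed
  have 1: "prob (?S (Suc n) - ?P) = class_cdf j (Suc n) k"
    unfolding class_cdf_def using disj
    by (rule finite_measure_eq_AE) (intro sets.Diff position_event meeting_event)+
  have sub: "?P \<subseteq> ?S n" unfolding meeting_def by auto
  have "?Q \<inter> ?P = {}" using pos R by (metis disjoint_iff)
  then have QP: "?Q - ?P = ?Q" by (rule Diff_triv)
  have "prob ((?S n - ?P) \<union> (?Q - ?P)) = prob (?S n - ?P) + prob ?Q"
    unfolding QP
  proof (rule finite_measure_Union)
    show "(?S n - ?P) \<inter> ?Q = {}" using pos site_inject by fastforce
  qed (intro sets.Diff position_event meeting_event)+
  also have "prob (?S n - ?P) = class_cdf j n k - prob ?P"
    unfolding class_cdf_def by (rule finite_measure_Diff[OF position_event meeting_event sub])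
  finally have "class_cdf j (Suc n) k = class_cdf j n k - prob ?P + prob ?Q" using e 1 by simp
  also have "prob ?P = r * q * (class_cdf j n k - class_cdf j n (k - 1)) ^ Suc m"
    unfolding prob_meeting step_right class_cdf_diff by simp
  also have "prob ?Q = (1 - r) * q * (class_cdf j n (k + 1) - class_cdf j n k) ^ Suc m"
    unfolding prob_meeting step_left using class_cdf_diff[of j n "k + 1"] by simp
  finally show ?thesis unfolding hj_step_def .
qed

lemma position_tight:
  assumes "0 < \<epsilon>"
  shows "\<exists>i0\<ge>0. prob {\<omega> \<in> space M. i0 < \<bar>X n \<omega>\<bar>} \<le> \<epsilon>"
proof -
  let ?A = "\<lambda>i::nat. {\<omega> \<in> space M. int i < \<bar>X n \<omega>\<bar>}"
  have "(\<lambda>i. prob (?A i)) \<longlonglongrightarrow> prob (\<Inter>i. ?A i)"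
    by (rule finite_Lim_measure_decseq) (auto simp: decseq_def intro: position_event)
  moreover have "(\<Inter>i. ?A i) = {}"
  proof (rule ccontr)
    assume "(\<Inter>i. ?A i) \<noteq> {}"
    then obtain \<omega> where "\<And>i. \<omega> \<in> ?A i" by blast
    from this[of "nat \<bar>X n \<omega>\<bar>"] show False by simp
  qed
  ultimately have "(\<lambda>i. prob (?A i)) \<longlonglongrightarrow> 0" by simp
  then have "eventually (\<lambda>i. prob (?A i) < \<epsilon>) sequentially" using assms by (rule order_tendstoD)
  then obtain i where "prob (?A i) < \<epsilon>" by (auto simp: eventually_sequentially)
  then show ?thesis by (intro exI[of _ "int i"]) auto
qed

lemma site_bounds:
  assumes "j \<in> {1..R}"
  shows "k + 1 \<le> 0 \<Longrightarrow> site j k \<le> k + 1" "0 \<le> k \<Longrightarrow> k \<le> site j k"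
proof -
  have R1: "1 \<le> int R" using R_pos by simp
  show "site j k \<le> k + 1" if "k + 1 \<le> 0"
  proof -
    have "site j k \<le> int R * (k + 1)" using assms by (simp add: site_def algebra_simps)
    also have "\<dots> \<le> 1 * (k + 1)" using R1 that by (intro mult_right_mono_neg) auto
    finally show ?thesis by simp
  qed
  show "k \<le> site j k" if "0 \<le> k"
  proof -
    have "1 * k \<le> int R * k" using R1 that by (intro mult_right_mono) auto
    then show ?thesis by (simp add: site_def)
  qed
qed

text \<open>
  The tail conditions are tightness of the law of the position at a fixed time.
\<close>

lemma conservative_scheme_class:
  assumes j: "j \<in> {1..R}"
  shows "conservative_scheme m q r (class_mass j) (class_cdf j)"
proof
  show "m \<ge> 1" "0 < q" "q \<le> 1" "1 / 2 < r" "r \<le> 1" by (fact m_pos q_range r_range)+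
  show "q * r < 1"
  proof (cases "q = 1")
    case True
    then show ?thesis using r_range not_deterministic by auto
  next
    case False
    have "q * r \<le> q * 1" using q_range r_range by (intro mult_left_mono) auto
    then show ?thesis using False q_range by linarith
  qed
  show "class_mass j \<le> 1" unfolding class_mass_def by simp
  show "class_cdf j n (k - 1) \<le> class_cdf j n k" for n k
    using class_cdf_diff[of j n k] measure_nonneg[of M "{\<omega> \<in> space M. X n \<omega> = site j k}"] by linarith
  show "0 \<le> class_cdf j n k" for n k by (simp add: class_cdf_def)
  show "class_cdf j n k \<le> class_mass j" for n k
    unfolding class_cdf_def class_mass_eq[of n j, symmetric]
    by (intro finite_measure_mono position_event) auto
  show "class_cdf j (Suc n) k = hj_step m (r * q) ((1 - r) * q) (class_cdf j n (k - 1)) (class_cdf j n k)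
      (class_cdf j n (k + 1))" for n k by (rule class_cdf_step)
  fix n and \<epsilon> :: real assume "0 < \<epsilon>"
  then obtain i0 where i0: "0 \<le> i0" "prob {\<omega> \<in> space M. i0 < \<bar>X n \<omega>\<bar>} \<le> \<epsilon>"
    using position_tight by blast
  have "class_cdf j n k \<le> \<epsilon>" if k: "k \<le> - i0 - 2" for k
  proof -
    have "i0 < \<bar>site j i\<bar>" if "i \<le> k" for i using site_bounds(1)[OF j, of i] that k i0 by linarith
    then have "class_cdf j n k \<le> prob {\<omega> \<in> space M. i0 < \<bar>X n \<omega>\<bar>}"
      unfolding class_cdf_def by (intro finite_measure_mono position_event) auto
    then show ?thesis using i0 by linarith
  qed
  then show "\<exists>K. \<forall>k\<le>K. class_cdf j n k \<le> \<epsilon>" by blast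
  have "class_mass j - \<epsilon> \<le> class_cdf j n k" if k: "k \<ge> i0" for k
  proof -
    have far: "i0 < \<bar>site j i\<bar>" if "\<not> i \<le> k" for i using site_bounds(2)[OF j, of i] that k i0 by linarith
    have "{\<omega> \<in> space M. \<exists>i. X n \<omega> = site j i}
        \<subseteq> {\<omega> \<in> space M. \<exists>i\<le>k. X n \<omega> = site j i} \<union> {\<omega> \<in> space M. i0 < \<bar>X n \<omega>\<bar>}"
    proof
      fix \<omega> assume "\<omega> \<in> {\<omega> \<in> space M. \<exists>i. X n \<omega> = site j i}"
      then obtain i where i: "\<omega> \<in> space M" "X n \<omega> = site j i" by blast
      show "\<omega> \<in> {\<omega> \<in> space M. \<exists>i\<le>k. X n \<omega> = site j i} \<union> {\<omega> \<in> space M. i0 < \<bar>X n \<omega>\<bar>}"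
      proof (cases "i \<le> k")
        case False
        then show ?thesis using far[OF False] i by simp
      qed (use i in blast)
    qed
    then have "class_mass j \<le> prob ({\<omega> \<in> space M. \<exists>i\<le>k. X n \<omega> = site j i} \<union> {\<omega> \<in> space M. i0 < \<bar>X n \<omega>\<bar>})"
      unfolding class_mass_eq[of n j, symmetric] by (intro finite_measure_mono sets.Un position_event)
    also have "\<dots> \<le> class_cdf j n k + prob {\<omega> \<in> space M. i0 < \<bar>X n \<omega>\<bar>}"
      unfolding class_cdf_def by (intro measure_Un_le position_event)
    finally show ?thesis using i0 by linarith
  qed
  then show "\<exists>K. \<forall>k\<ge>K. class_mass j - \<epsilon> \<le> class_cdf j n k" by blast
qed

lemma site_cover: "\<exists>j\<in>{1..R}. \<exists>i. x = site j i"
proof -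
  define j where "j = nat ((x - 1) mod int R) + 1"
  have b: "0 \<le> (x - 1) mod int R" "(x - 1) mod int R < int R" using R_pos by simp_all
  then have "j \<in> {1..R}" by (auto simp: j_def)
  moreover have "x = site j ((x - 1) div int R)"
    using b mult_div_mod_eq[of "int R" "x - 1"] by (simp add: site_def j_def)
  ultimately show ?thesis by blast
qed

lemma site_class_unique:
  assumes "site j i = site j' i'" "j \<in> {1..R}" "j' \<in> {1..R}"
  shows "j = j'"
proof -
  have "(site h k - 1) mod int R = int (h - 1)" if "h \<in> {1..R}" for h k
  proof -
    have "site h k - 1 = int (h - 1) + int R * k" using that by (simp add: site_def of_nat_diff)
    then have "(site h k - 1) mod int R = int (h - 1) mod int R" by simp
    also have "\<dots> = int (h - 1)" using that by (intro mod_pos_pos_trivial) auto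
    finally show ?thesis .
  qed
  then have "int (j - 1) = int (j' - 1)" using assms by metis
  then have "j - 1 = j' - 1" by simp
  then show ?thesis using assms by auto
qed

lemma prob_position_le:
  "prob {\<omega> \<in> space M. real_of_int (X n \<omega>) \<le> y} = (\<Sum>j\<in>{1..R}. class_cdf j n \<lfloor>(y - real j) / real R\<rfloor>)"
proof -
  let ?E = "\<lambda>j. {\<omega> \<in> space M. \<exists>i\<le>\<lfloor>(y - real j) / real R\<rfloor>. X n \<omega> = site j i}"
  have le: "i \<le> \<lfloor>(y - real j) / real R\<rfloor> \<longleftrightarrow> real_of_int (site j i) \<le> y" for i j
    using R_pos by (simp add: le_floor_iff site_def pos_le_divide_eq le_diff_eq mult.commute)
  have "{\<omega> \<in> space M. real_of_int (X n \<omega>) \<le> y} = (\<Union>j\<in>{1..R}. ?E j)"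
  proof (intro equalityI subsetI)
    fix \<omega> assume \<omega>: "\<omega> \<in> {\<omega> \<in> space M. real_of_int (X n \<omega>) \<le> y}"
    obtain j i where "j \<in> {1..R}" "X n \<omega> = site j i" using site_cover by blast
    then show "\<omega> \<in> (\<Union>j\<in>{1..R}. ?E j)" using \<omega> le by auto
  qed (use le in auto)
  moreover have "prob (\<Union>j\<in>{1..R}. ?E j) = (\<Sum>j\<in>{1..R}. prob (?E j))"
  proof (rule finite_measure_finite_Union)
    show "disjoint_family_on ?E {1..R}"
      unfolding disjoint_family_on_def using site_class_unique by fastforce
  qed (use position_event in auto)
  ultimately show ?thesis by (simp add: class_cdf_def)
qed

end

section \<open>The limit law\<close>

lemma spatial_scale_tendsto_0:
  assumes "0 < \<sigma>"
  shows "spatial_scale m \<sigma> \<longlonglongrightarrow> 0"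
proof -
  have "(\<lambda>n. real m ^ m / \<sigma> * (1 / real n)) \<longlonglongrightarrow> real m ^ m / \<sigma> * 0"
    by (intro tendsto_intros lim_1_over_n)
  then have "(\<lambda>n. (real m ^ m / \<sigma> * (1 / real n)) powr (1 / (real m + 1))) \<longlonglongrightarrow> (real m ^ m / \<sigma> * 0) powr (1 / (real m + 1))"
    using assms by (intro tendsto_powr' tendsto_const) auto
  then have "(\<lambda>n. 1 / (real m + 1) * (real m ^ m / \<sigma> * (1 / real n)) powr (1 / (real m + 1))) \<longlonglongrightarrow> 1 / (real m + 1) * 0"
    by (intro tendsto_mult tendsto_const) simp
  then show ?thesis by (simp add: spatial_scale_def [abs_def])
qed

lemma spatial_scale_pos: "m \<ge> 1 \<Longrightarrow> 0 < \<sigma> \<Longrightarrow> n \<ge> 1 \<Longrightarrow> 0 < spatial_scale m \<sigma> n"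
  by (simp add: spatial_scale_def)

text \<open>
  The event that the scaled position is at most \<open>x\<close> is a half line in each class.  Its endpoint differs from
  \<open>x\<close> divided by the spatial scale by a bounded number of sites, which the scaling removes.
\<close>

lemma (in lazy_cooperative_motion) cdf_scaled_position_tendsto:
  defines "\<sigma> \<equiv> (2 * r - 1) * q"
  shows "(\<lambda>n. prob {\<omega> \<in> space M. 1 / real R * spatial_scale m \<sigma> n * real_of_int (X n \<omega>) \<le> x})
    \<longlonglongrightarrow> (\<Sum>j\<in>{1..R}. min (class_mass j) (beta_profile m x))"
proof -
  let ?s = "spatial_scale m \<sigma>"
  have \<sigma>: "0 < \<sigma>" using q_range r_range by (simp add: \<sigma>_def)
  have R: "0 < real R" using R_pos by simp
  define K where "K j n = \<lfloor>(x * real R / ?s n - real j) / real R\<rfloor>" for j n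
  have "(\<lambda>n. class_cdf j n (K j n)) \<longlonglongrightarrow> min (class_mass j) (beta_profile m x)" if j: "j \<in> {1..R}" for j
  proof -
    interpret C: conservative_scheme m q r "class_mass j" "class_cdf j"
      by (rule conservative_scheme_class[OF j])
    have drift: "C.drift = \<sigma>" by (simp add: C.drift_def \<sigma>_def)
    have "(\<lambda>n. ?s n * real_of_int (K j n)) \<longlonglongrightarrow> x"
    proof (rule tendsto_sandwich)
      have split: "?s n * ((x * real R / ?s n - real j) / real R) = x - ?s n * (real j / real R)" if "0 < ?s n" for n
        using R that by (simp add: field_simps)
      show "\<forall>\<^sub>F n in sequentially. x - ?s n * (real j / real R) - ?s n \<le> ?s n * real_of_int (K j n)"
        using eventually_ge_at_top[of 1]
      proof eventually_elim
        case (elim n)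
        then have s: "0 < ?s n" using spatial_scale_pos m_pos \<sigma> by blast
        have "(x * real R / ?s n - real j) / real R - 1 \<le> real_of_int (K j n)"
          unfolding K_def by linarith
        from mult_left_mono[OF this less_imp_le[OF s]] show ?case
          using split[OF s] by (simp add: right_diff_distrib)
      qed
      show "\<forall>\<^sub>F n in sequentially. ?s n * real_of_int (K j n) \<le> x - ?s n * (real j / real R)"
        using eventually_ge_at_top[of 1]
      proof eventually_elim
        case (elim n)
        then have s: "0 < ?s n" using spatial_scale_pos m_pos \<sigma> by blast
        have "real_of_int (K j n) \<le> (x * real R / ?s n - real j) / real R"
          unfolding K_def by linarith
        from mult_left_mono[OF this less_imp_le[OF s]] show ?case unfolding split[OF s] .
      qed
      have "(\<lambda>n. x - ?s n * (real j / real R) - ?s n) \<longlonglongrightarrow> x - 0 * (real j / real R) - 0"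
        by (intro tendsto_intros spatial_scale_tendsto_0 \<sigma>)
      then show "(\<lambda>n. x - ?s n * (real j / real R) - ?s n) \<longlonglongrightarrow> x" by simp
      have "(\<lambda>n. x - ?s n * (real j / real R)) \<longlonglongrightarrow> x - 0 * (real j / real R)"
        by (intro tendsto_intros spatial_scale_tendsto_0 \<sigma>)
      then show "(\<lambda>n. x - ?s n * (real j / real R)) \<longlonglongrightarrow> x" by simp
    qed
    then show ?thesis by (intro C.scaling_limit) (simp add: drift)
  qed
  then have "(\<lambda>n. \<Sum>j\<in>{1..R}. class_cdf j n (K j n)) \<longlonglongrightarrow> (\<Sum>j\<in>{1..R}. min (class_mass j) (beta_profile m x))"
    by (intro tendsto_sum) auto
  then show ?thesis
  proof (rule Lim_transform_eventually)
    show "\<forall>\<^sub>F n in sequentially. (\<Sum>j\<in>{1..R}. class_cdf j n (K j n))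
        = prob {\<omega> \<in> space M. 1 / real R * ?s n * real_of_int (X n \<omega>) \<le> x}"
      using eventually_ge_at_top[of 1]
    proof eventually_elim
      case (elim n)
      then have s: "0 < ?s n" using spatial_scale_pos m_pos \<sigma> by blast
      have "1 / real R * ?s n * y \<le> x \<longleftrightarrow> y \<le> x * real R / ?s n" for y
        using s R by (simp add: field_simps)
      then show ?case unfolding K_def by (simp add: prob_position_le)
    qed
  qed
qed

text \<open>
  The exponents \<open>m / (m + 1)\<close> and \<open>(m + 1) / m\<close> cancel: \<open>w\<close> times the Beta distribution function at
  \<open>x / w powr (m / (m + 1))\<close> is \<open>x powr ((m + 1) / m)\<close> up to the point where this reaches \<open>w\<close>.
\<close>

lemma beta_mixture_component:
  assumes m: "m \<ge> 1" and w: "0 < w"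
  shows "w * beta_one_cdf ((real m + 1) / real m) (x / w powr (real m / (real m + 1))) = min w (beta_profile m x)"
proof -
  define \<alpha> where "\<alpha> = (real m + 1) / real m"
  define u where "u = w powr (real m / (real m + 1))"
  have u: "0 < u" using w by (simp add: u_def)
  have \<alpha>: "0 < \<alpha>" using m by (simp add: \<alpha>_def)
  have ua: "u powr \<alpha> = w" using w m by (simp add: u_def \<alpha>_def powr_powr)
  have prof: "beta_profile m x = max 0 x powr \<alpha>" by (simp add: beta_profile_def \<alpha>_def add.commute)
  consider "x < 0" | "0 \<le> x" "x \<le> u" | "u < x" "0 \<le> x" using u by linarith
  then have "w * beta_one_cdf \<alpha> (x / u) = min w (max 0 x powr \<alpha>)"
  proof cases
    case 1
    then have "x / u < 0" using u by (simp add: divide_neg_pos)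
    then show ?thesis using 1 w by (simp add: beta_one_cdf_def)
  next
    case 2
    have "x / u \<le> 1" "\<not> x / u < 0" using 2 u by (auto simp: divide_less_0_iff)
    then have "w * beta_one_cdf \<alpha> (x / u) = w * (x powr \<alpha> / w)"
      using 2 u ua by (simp add: beta_one_cdf_def powr_divide)
    moreover have "x powr \<alpha> \<le> w" using powr_mono2[of \<alpha> x u] \<alpha> 2 ua by simp
    ultimately show ?thesis using w 2 by simp
  next
    case 3
    have "\<not> x / u \<le> 1" "\<not> x / u < 0" using 3 u by (auto simp: divide_less_0_iff)
    moreover have "w \<le> x powr \<alpha>" using powr_mono2[of \<alpha> u x] \<alpha> u 3 ua by simp
    ultimately show ?thesis using 3 by (simp add: beta_one_cdf_def)
  qed
  then show ?thesis unfolding prof \<alpha>_def u_def .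
qed

lemma (in prob_space) cdf_distr_eq:
  assumes "f \<in> borel_measurable M"
  shows "cdf (distr M borel f) x = prob {\<omega> \<in> space M. f \<omega> \<le> x}"
proof -
  have "f -` {..x} \<inter> space M = {\<omega> \<in> space M. f \<omega> \<le> x}" by auto
  then show ?thesis using assms by (simp add: cdf_def measure_distr)
qed

lemma (in prob_space) cdf_beta_mixture:
  fixes A :: "'a \<Rightarrow> nat" and B :: "'a \<Rightarrow> real" and p :: "nat \<Rightarrow> real"
  assumes m: "m \<ge> 1" and A: "A \<in> measurable M (count_space UNIV)"
    and range: "\<And>\<omega>. \<omega> \<in> space M \<Longrightarrow> A \<omega> \<in> {1..R}"
    and p: "\<And>j. j \<in> {1..R} \<Longrightarrow> prob {\<omega> \<in> space M. A \<omega> = j} = p j"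
    and B: "beta_one_distributed M ((real m + 1) / real m) B"
    and indep: "indep_var borel (\<lambda>\<omega>. real (A \<omega>)) borel B"
  defines "Y \<equiv> \<lambda>\<omega>. B \<omega> * (\<Sum>j = 1..R. p j powr (real m / (real m + 1)) * indicator {\<omega>'. A \<omega>' = j} \<omega>)"
  shows "cdf (distr M borel Y) x = (\<Sum>j\<in>{1..R}. min (p j) (beta_profile m x))"
proof -
  let ?w = "\<lambda>j. p j powr (real m / (real m + 1))"
  have Bm: "B \<in> borel_measurable M"
    and Bcdf: "cdf (distr M borel B) = beta_one_cdf ((real m + 1) / real m)"
    using B unfolding beta_one_distributed_def by auto
  have Aev: "{\<omega> \<in> space M. A \<omega> = j} \<in> events" for j
  proof -
    have "A -` {j} \<inter> space M \<in> events" by (rule measurable_sets[OF A]) simp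
    then show ?thesis by (simp add: vimage_def Int_def conj_commute)
  qed
  have Y: "Y \<omega> = B \<omega> * ?w (A \<omega>)" if "\<omega> \<in> space M" for \<omega>
  proof -
    have "(\<Sum>j = 1..R. ?w j * indicator {\<omega>'. A \<omega>' = j} \<omega>) = (\<Sum>j = 1..R. if j = A \<omega> then ?w j else 0)"
      by (intro sum.cong) (auto simp: indicator_def)
    also have "\<dots> = ?w (A \<omega>)" using range[OF that] by simp
    finally show ?thesis by (simp add: Y_def)
  qed
  have Bev: "{\<omega> \<in> space M. B \<omega> * c \<le> x} \<in> events" for c using Bm by measurable
  have Ym: "Y \<in> borel_measurable M"
  proof -
    have "indicator {\<omega>'. A \<omega>' = j} \<in> borel_measurable M" for j
    proof -
      have "indicator {\<omega> \<in> space M. A \<omega> = j} \<in> borel_measurable M" using Aev by simp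
      then show ?thesis by (rule measurable_cong[THEN iffD1, rotated]) (auto simp: indicator_def)
    qed
    then show ?thesis unfolding Y_def using Bm by measurable
  qed
  have "cdf (distr M borel Y) x = prob {\<omega> \<in> space M. Y \<omega> \<le> x}"
    using Ym by (rule cdf_distr_eq)
  also have "{\<omega> \<in> space M. Y \<omega> \<le> x} = (\<Union>j\<in>{1..R}. {\<omega> \<in> space M. A \<omega> = j} \<inter> {\<omega> \<in> space M. B \<omega> * ?w j \<le> x})"
    using Y range by (auto; metis)
  also have "prob \<dots> = (\<Sum>j\<in>{1..R}. prob ({\<omega> \<in> space M. A \<omega> = j} \<inter> {\<omega> \<in> space M. B \<omega> * ?w j \<le> x}))"
    using Aev Bev by (intro finite_measure_finite_Union) (auto simp: disjoint_family_on_def)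
  also have "\<dots> = (\<Sum>j\<in>{1..R}. min (p j) (beta_profile m x))"
  proof (rule sum.cong)
    fix j assume j: "j \<in> {1..R}"
    have p0: "0 \<le> p j" using p[OF j] by (metis measure_nonneg)
    have "{\<omega> \<in> space M. A \<omega> = j} \<inter> {\<omega> \<in> space M. B \<omega> * ?w j \<le> x}
        = (\<lambda>\<omega>. (real (A \<omega>), B \<omega>)) -` ({real j} \<times> {b. b * ?w j \<le> x}) \<inter> space M" by auto
    also have "prob \<dots> = prob ((\<lambda>\<omega>. real (A \<omega>)) -` {real j} \<inter> space M) * prob (B -` {b. b * ?w j \<le> x} \<inter> space M)"
      by (rule indep_varD[OF indep]) (simp, measurable)
    also have "(\<lambda>\<omega>. real (A \<omega>)) -` {real j} \<inter> space M = {\<omega> \<in> space M. A \<omega> = j}" by auto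
    also have "prob {\<omega> \<in> space M. A \<omega> = j} = p j" by (rule p[OF j])
    also have "p j * prob (B -` {b. b * ?w j \<le> x} \<inter> space M) = min (p j) (beta_profile m x)"
    \<comment> \<open>A class without mass contributes \<open>0\<close> on both sides, where the division by its scale would be meaningless.\<close>
    proof (cases "p j = 0")
      case True
      then show ?thesis using beta_profile_nonneg[of m x] by simp
    next
      case False
      then have pj: "0 < p j" using p0 by simp
      then have "{b. b * ?w j \<le> x} = {..x / ?w j}" by (auto simp: field_simps)
      then have "prob (B -` {b. b * ?w j \<le> x} \<inter> space M) = cdf (distr M borel B) (x / ?w j)"
        using Bm by (simp add: cdf_def measure_distr)
      then show ?thesis unfolding Bcdf using beta_mixture_component[OF m pj] by simp
    qed
    finally show "prob ({\<omega> \<in> space M. A \<omega> = j} \<inter> {\<omega> \<in> space M. B \<omega> * ?w j \<le> x}) = min (p j) (beta_profile m x)" .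
  qed simp
  finally show ?thesis .
qed

theorem theorem5p1:
  fixes M :: "'a measure" and N :: "'b measure"
    and m R :: nat and q r \<sigma> :: real
    and \<mu> :: "int pmf"
    and X :: "nat \<Rightarrow> 'a \<Rightarrow> int" and Xc :: "nat \<Rightarrow> nat \<Rightarrow> 'a \<Rightarrow> int" and D :: "nat \<Rightarrow> 'a \<Rightarrow> int"
    and p :: "nat \<Rightarrow> real"
    and A :: "'b \<Rightarrow> nat" and B :: "'b \<Rightarrow> real"
  assumes "m \<ge> 1"
    and "0 < q" and "q \<le> 1"
    and "1 / 2 < r" and "r \<le> 1"
    and "\<not> (r = 1 \<and> q = 1)"
    and "R > 0"
    and "\<sigma> = (2 * r - 1) * q"
    and "generalized_cooperative_motion M m \<mu> X Xc D"
    and "\<And>n. measure M {\<omega> \<in> space M. D n \<omega> = int R} = r * q"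
    and "\<And>n. measure M {\<omega> \<in> space M. D n \<omega> = 0} = 1 - q"
    and "\<And>n. measure M {\<omega> \<in> space M. D n \<omega> = - int R} = (1 - r) * q"
    and "\<And>j. j \<in> {1..R} \<Longrightarrow> p j = measure M {\<omega> \<in> space M. [X 0 \<omega> = int j] (mod int R)}"
    and "prob_space N"
    and "A \<in> measurable N (count_space UNIV)"
    and "\<And>\<omega>. \<omega> \<in> space N \<Longrightarrow> A \<omega> \<in> {1..R}"
    and "\<And>j. j \<in> {1..R} \<Longrightarrow> measure N {\<omega> \<in> space N. A \<omega> = j} = p j"
    and "beta_one_distributed N ((real m + 1) / real m) B"
    and "prob_space.indep_var N borel (\<lambda>\<omega>. real (A \<omega>)) borel B"
  shows "weak_conv_m
    (\<lambda>n. distr M borel (\<lambda>\<omega>. 1 / real R * (1 / (real m + 1)) *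
            (real m ^ m / (\<sigma> * real n)) powr (1 / (real m + 1)) * real_of_int (X n \<omega>)))
    (distr N borel (\<lambda>\<omega>. B \<omega> *
            (\<Sum>j = 1..R. p j powr (real m / (real m + 1)) * indicator {\<omega>'. A \<omega>' = j} \<omega>)))"
proof -
  interpret motion: lazy_cooperative_motion M m \<mu> X Xc D q r R
    by (intro lazy_cooperative_motion.intro lazy_cooperative_motion_axioms.intro assms)
  interpret N: prob_space N by (rule assms)
  have mass: "motion.class_mass j = p j" if j: "j \<in> {1..R}" for j
  proof -
    have "[x = int j] (mod int R) \<longleftrightarrow> (\<exists>i. x = motion.site j i)" for x
    proof -
      have "[x = int j] (mod int R) \<longleftrightarrow> [int j = x] (mod int R)" by (rule cong_sym_eq)
      then show ?thesis by (simp add: cong_iff_lin motion.site_def add.commute)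
    qed
    then show ?thesis unfolding motion.class_mass_def assms(13)[OF j] by simp
  qed
  show ?thesis unfolding weak_conv_m_def weak_conv_def
  proof (intro allI impI)
    fix x
    let ?Z = "\<lambda>n \<omega>. 1 / real R * (1 / (real m + 1)) *
            (real m ^ m / (\<sigma> * real n)) powr (1 / (real m + 1)) * real_of_int (X n \<omega>)"
    have "cdf (distr M borel (?Z n)) x
        = motion.prob {\<omega> \<in> space M. 1 / real R * spatial_scale m \<sigma> n * real_of_int (X n \<omega>) \<le> x}" for n
    proof -
      have "?Z n \<in> borel_measurable M"
      proof (rule measurable_compose[OF motion.position_measurable])
        show "(\<lambda>k. 1 / real R * (1 / (real m + 1)) *
            (real m ^ m / (\<sigma> * real n)) powr (1 / (real m + 1)) * real_of_int k) \<in> borel_measurable (count_space UNIV)"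
          by simp
      qed
      then show ?thesis
        unfolding spatial_scale_def mult.assoc [symmetric] by (rule motion.cdf_distr_eq)
    qed
    moreover have "cdf (distr N borel (\<lambda>\<omega>. B \<omega> *
            (\<Sum>j = 1..R. p j powr (real m / (real m + 1)) * indicator {\<omega>'. A \<omega>' = j} \<omega>))) x
        = (\<Sum>j\<in>{1..R}. min (motion.class_mass j) (beta_profile m x))"
      using N.cdf_beta_mixture[OF assms(1,15-19)] mass by simp
    ultimately show "(\<lambda>n. cdf (distr M borel (?Z n)) x) \<longlonglongrightarrow> cdf (distr N borel (\<lambda>\<omega>. B \<omega> *
            (\<Sum>j = 1..R. p j powr (real m / (real m + 1)) * indicator {\<omega>'. A \<omega>' = j} \<omega>))) x"
      using motion.cdf_scaled_position_tendsto[of x] assms(8) by simp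
  qed
qed

end
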